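(* Let $\mathcal H^{(1)}=\mathcal H^{(1)}_R(a,b)$ be a generic pro-$p$ Hecke algebra for a pro-$p$ Coxeter group $W^{(1)}$ whose parameters $a_s$ are units and squares in $R$, with a choice of square roots and associated normalized Bernstein map $\widetilde\theta$ and elements $\Xi_{\mathfrak o}(H)$ (notation as in the context). Let $w\in W^{(1)}$ and let $\mathfrak o,\mathfrak o'$ be adjacent orientations of $W^{(1)}$. Then \[ \widetilde\theta_{\mathfrak o}(w)-\widetilde\theta_{\mathfrak o'}(w)=\Big(\sum_H\mathfrak o(1,H)\,\Xi_{\mathfrak o'}(H)\Big)\widetilde\theta_{\mathfrak o}(w), \] where the sum is taken over all hyperplanes $H\in\mathfrak H$ which separate $1$ and $\pi(w)$ and at which $\mathfrak o$ and $\mathfrak o'$ disagree.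
   Context: Coxeter group $(W_{\mathrm{aff}},S)$, length $\ell$, $m(s,t)$ the order of $st$, hyperplanes $\mathfrak H=\{vsv^{-1}:v\in W_{\mathrm{aff}},s\in S\}$; for $v=s_1\cdots s_r$ reduced the hyperplanes separating $1,v$ are $(s_1\cdots s_{i-1})s_i(s_1\cdots s_{i-1})^{-1}$; $H$ separates $v_1,v_2$ iff $v_1^{-1}Hv_1$ separates $1,v_1^{-1}v_2$. Extended Coxeter group $W=W_{\mathrm{aff}}\rtimes\Omega$ ($\Omega$ preserving $S$), $\ell(vu)=\ell(v)$, $vu$ identified with chamber $v$. Pro-$p$ Coxeter group: $1\to T\to W^{(1)}\xrightarrow{\pi}W\to1$, $T$ abelian, lifts $n_s\in\pi^{-1}(s)$ with braid relations, length $\ell\circ\pi$, $\Omega^{(1)}=\pi^{-1}(\Omega)$; $W^{(1)}$ acts on $T$, $R[T]$ by conjugation $w(\cdot)$. Generic pro-$p$ Hecke algebra $\mathcal H^{(1)}_R(a,b)$: $a_s\in R$, $b_s\in R[T]$ with $a_s=a_t$ and $(n_swn_t^{-1}w^{-1})w(b_t)=b_s$ whenever $s\pi(w)=\pi(w)t$; free on $\{T_w\}$, $T_{ww'}=T_wT_{w'}$ if lengths add, $T_{n_s}^2=a_sT_{n_s^2}+T_{n_s}b_s$, $R[T]$ embedded by $t\mapsto T_t$. $a_s$ depends only on the $W$-conjugacy class of $s$; $a_H:=a_s$ for $H$ conjugate to $s$; choose a square root $\sqrt{a_H}\in R^\times$ depending only on the class. Orientations of $W^{(1)}$: maps $(w,s)\mapsto\mathfrak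 o_0(v,usu^{-1})$ with $\pi(w)=vu$, $\mathfrak o_0:W_{\mathrm{aff}}\times S\to\{\pm1\}$ satisfying (OR1) $\mathfrak o_0(vs,s)=-\mathfrak o_0(v,s)$ and (OR2) (for $m(s,t)<\infty$, the sign sequences along $v,vs,vst,\dots$ and $v,vt,vts,\dots$ are ($k$ pluses, $m-k$ minuses) and ($m-k$ minuses, $k$ pluses), or both reversed). Right action $(\mathfrak o\bullet w)(w',s)=\mathfrak o(ww',s)$; $T$ acts trivially, so $\mathfrak o\bullet x$ makes sense for $x\in W$ via any lift. For $H\in\mathfrak H$, $\mathfrak o(1,H):=\mathfrak o(v_0,s)$ for any $v_0\in W_{\mathrm{aff}}$ (or a lift), $s\in S$ with $v_0sv_0^{-1}=H$ and $H$ not separating $1$ and $v_0$ (independent of choices). $\mathfrak o,\mathfrak o'$ disagree at $H$ if $\mathfrak o(1,H)\ne\mathfrak o'(1,H)$; they are adjacent if for every $H$ at which they disagree, $\mathfrak o\bullet s_H=\mathfrak o'$, where $s_H=H\in W_{\mathrm{aff}}$. Integral Bernstein map: $\widehat\theta_{\mathfrak o}(w)=T_1\cdots T_rT_u$ for $w=n_{s_1}\cdots n_{s_r}u$, $u\in\Omega^{(1)}$, $r=\ell(w)$, with $T_i=T_{n_{s_i}}$ if $\mathfrak o(n_{s_1}\cdots n_{s_{i-1}},s_i)=+1$ and $T_{n_{s_i}}-b_{s_i}$ otherwise (independent of expression). Normalized: $\widetilde\theta_{\mathfrak o}(w)=\overline{\sqrt{\mathbb L}}(w)^{-1}\widehat\theta_{\mathfrak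 o}(w)$, where $\overline{\sqrt{\mathbb L}}(w)=\prod_H\sqrt{a_H}$ over $H$ separating $1$ and $\pi(w)$. For $H\in\mathfrak H$, $\Xi_{\mathfrak o}(H):=\sqrt{a_s}^{-1}\,w(b_s)\,\widetilde\theta_{\mathfrak o}(wn_s^{-1}w^{-1})$ for any $w\in W^{(1)}$, $s\in S$ with $\pi(wn_sw^{-1})=H$ (this element is independent of the choice of $w,s$). *)

theory Defs
  imports "HOL-Algebra.Coset"
begin

text \<open>All data in one record:
  Wg  = the extended Coxeter group W (a group, elements of type 'w),
  Waf = the subgroup W_aff, Sg = the Coxeter generators S, Omg = the subgroup Omega,
  W1g = the pro-p Coxeter group W^(1) (elements of type 'v), prj = pi : W^(1) -> W,
  nl  = the chosen lifts s |-> n_s,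
  ap  = the parameters s |-> a_s in R, bp = the parameters s |-> b_s in R[T]
        (elements of R[T] are finitely supported functions T -> R, extended by 0),
  io  = the structure map R -> H (scalars), Tb = the basis w |-> T_w of H,
  sq  = the chosen square roots s |-> sqrt(a_s).\<close>

record ('w, 'v, 'r, 'h) phdata =
  Wg  :: "'w monoid"
  Waf :: "'w set"
  Sg  :: "'w set"
  Omg :: "'w set"
  W1g :: "'v monoid"
  prj :: "'v \<Rightarrow> 'w"
  nl  :: "'w \<Rightarrow> 'v"
  ap  :: "'w \<Rightarrow> 'r"
  bp  :: "'w \<Rightarrow> 'v \<Rightarrow> 'r"
  io  :: "'r \<Rightarrow> 'h"
  Tb  :: "'v \<Rightarrow> 'h"
  sq  :: "'w \<Rightarrow> 'r"

definition wprod :: "('a, 'b) monoid_scheme \<Rightarrow> 'a list \<Rightarrow> 'a" where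
  "wprod G xs = foldr (\<lambda>x y. x \<otimes>\<^bsub>G\<^esub> y) xs \<one>\<^bsub>G\<^esub>"

definition alt_word :: "'a \<Rightarrow> 'a \<Rightarrow> nat \<Rightarrow> 'a list" where
  "alt_word s t k = map (\<lambda>i. if even i then s else t) [0..<k]"

text \<open>m(s,t) = order of st; the value 0 encodes m(s,t) = infinity.\<close>
definition cox_m :: "('a, 'b) monoid_scheme \<Rightarrow> 'a \<Rightarrow> 'a \<Rightarrow> nat" where
  "cox_m G s t = (if \<exists>n::nat>0. (s \<otimes>\<^bsub>G\<^esub> t) [^]\<^bsub>G\<^esub> n = \<one>\<^bsub>G\<^esub>
                  then LEAST n::nat. n > 0 \<and> (s \<otimes>\<^bsub>G\<^esub> t) [^]\<^bsub>G\<^esub> n = \<one>\<^bsub>G\<^esub> else 0)"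

text \<open>One elementary move of the Coxeter presentation (as a monoid presentation on
  the involutions S, which presents the same group as the group presentation
  < S | s^2, (st)^m(s,t) >).\<close>
inductive cox_step :: "('a, 'b) monoid_scheme \<Rightarrow> 'a set \<Rightarrow> 'a list \<Rightarrow> 'a list \<Rightarrow> bool"
  for G S where
  sq_rel: "s \<in> S \<Longrightarrow> cox_step G S (u @ [s, s] @ v) (u @ v)"
| braid_rel: "s \<in> S \<Longrightarrow> t \<in> S \<Longrightarrow> cox_m G s t > 0 \<Longrightarrow>
     cox_step G S (u @ alt_word s t (2 * cox_m G s t) @ v) (u @ v)"

definition cox_equiv :: "('a, 'b) monoid_scheme \<Rightarrow> 'a set \<Rightarrow> 'a list \<Rightarrow> 'a list \<Rightarrow> bool" where
  "cox_equiv G S = (\<lambda>x y. cox_step G S x y \<or> cox_step G S y x)\<^sup>*\<^sup>*"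

definition coxeter_system :: "('a, 'b) monoid_scheme \<Rightarrow> 'a set \<Rightarrow> 'a set \<Rightarrow> bool" where
  "coxeter_system G Wa S \<longleftrightarrow> subgroup Wa G \<and> S \<subseteq> Wa \<and>
     (\<forall>s\<in>S. s \<noteq> \<one>\<^bsub>G\<^esub> \<and> s \<otimes>\<^bsub>G\<^esub> s = \<one>\<^bsub>G\<^esub>) \<and>
     Wa = wprod G ` lists S \<and>
     (\<forall>xs\<in>lists S. \<forall>ys\<in>lists S. wprod G xs = wprod G ys \<longrightarrow> cox_equiv G S xs ys)"

definition len_aff :: "('a, 'b) monoid_scheme \<Rightarrow> 'a set \<Rightarrow> 'a \<Rightarrow> nat" where
  "len_aff G S v = (LEAST r. \<exists>xs\<in>lists S. length xs = r \<and> wprod G xs = v)"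

definition reduced_expr :: "('a, 'b) monoid_scheme \<Rightarrow> 'a set \<Rightarrow> 'a list \<Rightarrow> 'a \<Rightarrow> bool" where
  "reduced_expr G S xs v \<longleftrightarrow> xs \<in> lists S \<and> wprod G xs = v \<and> length xs = len_aff G S v"

definition hyperplanes :: "('a, 'b) monoid_scheme \<Rightarrow> 'a set \<Rightarrow> 'a set \<Rightarrow> 'a set" where
  "hyperplanes G Wa S = {v \<otimes>\<^bsub>G\<^esub> s \<otimes>\<^bsub>G\<^esub> inv\<^bsub>G\<^esub> v | v s. v \<in> Wa \<and> s \<in> S}"

text \<open>Hyperplanes separating 1 and v (v in W_aff): for a reduced expression
  v = s_1 ... s_r these are (s_1...s_(i-1)) s_i (s_1...s_(i-1))^-1 (this set is
  independent of the reduced expression).\<close>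
definition sep1 :: "('a, 'b) monoid_scheme \<Rightarrow> 'a set \<Rightarrow> 'a \<Rightarrow> 'a set" where
  "sep1 G S v = {H. \<exists>xs. reduced_expr G S xs v \<and> (\<exists>i<length xs.
      H = wprod G (take i xs) \<otimes>\<^bsub>G\<^esub> (xs ! i) \<otimes>\<^bsub>G\<^esub> inv\<^bsub>G\<^esub> (wprod G (take i xs)))}"

definition ext_coxeter :: "('w, 'v, 'r, 'h) phdata \<Rightarrow> bool" where
  "ext_coxeter D \<longleftrightarrow> group (Wg D) \<and> coxeter_system (Wg D) (Waf D) (Sg D) \<and>
     Waf D \<lhd> Wg D \<and> subgroup (Omg D) (Wg D) \<and> Waf D \<inter> Omg D = {\<one>\<^bsub>Wg D\<^esub>} \<and>
     (\<forall>x\<in>carrier (Wg D). \<exists>v\<in>Waf D. \<exists>u\<in>Omg D. x = v \<otimes>\<^bsub>Wg D\<^esub> u) \<and>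
     (\<forall>u\<in>Omg D. \<forall>s\<in>Sg D. u \<otimes>\<^bsub>Wg D\<^esub> s \<otimes>\<^bsub>Wg D\<^esub> inv\<^bsub>Wg D\<^esub> u \<in> Sg D)"

definition aff_part :: "('w, 'v, 'r, 'h) phdata \<Rightarrow> 'w \<Rightarrow> 'w" where
  "aff_part D x = (THE v. v \<in> Waf D \<and> (\<exists>u\<in>Omg D. x = v \<otimes>\<^bsub>Wg D\<^esub> u))"

definition om_part :: "('w, 'v, 'r, 'h) phdata \<Rightarrow> 'w \<Rightarrow> 'w" where
  "om_part D x = (THE u. u \<in> Omg D \<and> (\<exists>v\<in>Waf D. x = v \<otimes>\<^bsub>Wg D\<^esub> u))"

definition lenW :: "('w, 'v, 'r, 'h) phdata \<Rightarrow> 'w \<Rightarrow> nat" where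
  "lenW D x = len_aff (Wg D) (Sg D) (aff_part D x)"

definition len1 :: "('w, 'v, 'r, 'h) phdata \<Rightarrow> 'v \<Rightarrow> nat" where
  "len1 D w = lenW D (prj D w)"

definition Tgrp :: "('w, 'v, 'r, 'h) phdata \<Rightarrow> 'v set" where
  "Tgrp D = kernel (W1g D) (Wg D) (prj D)"

definition Om1 :: "('w, 'v, 'r, 'h) phdata \<Rightarrow> 'v set" where
  "Om1 D = {w \<in> carrier (W1g D). prj D w \<in> Omg D}"

definition pro_p_coxeter :: "('w, 'v, 'r, 'h) phdata \<Rightarrow> bool" where
  "pro_p_coxeter D \<longleftrightarrow> ext_coxeter D \<and> group (W1g D) \<and>
     prj D \<in> hom (W1g D) (Wg D) \<and> prj D ` carrier (W1g D) = carrier (Wg D) \<and>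
     (\<forall>x\<in>Tgrp D. \<forall>y\<in>Tgrp D. x \<otimes>\<^bsub>W1g D\<^esub> y = y \<otimes>\<^bsub>W1g D\<^esub> x) \<and>
     (\<forall>s\<in>Sg D. nl D s \<in> carrier (W1g D) \<and> prj D (nl D s) = s) \<and>
     (\<forall>s\<in>Sg D. \<forall>t\<in>Sg D. s \<noteq> t \<longrightarrow> cox_m (Wg D) s t > 0 \<longrightarrow>
        wprod (W1g D) (map (nl D) (alt_word s t (cox_m (Wg D) s t))) =
        wprod (W1g D) (map (nl D) (alt_word t s (cox_m (Wg D) s t))))"

definition rt_elem :: "('w, 'v, 'r::zero, 'h) phdata \<Rightarrow> ('v \<Rightarrow> 'r) \<Rightarrow> bool" where
  "rt_elem D c \<longleftrightarrow> finite {t. c t \<noteq> 0} \<and> {t. c t \<noteq> 0} \<subseteq> Tgrp D"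

text \<open>Conjugation action of W^(1) on R[T]: w(t) = w t w^-1.\<close>
definition conj_act :: "('w, 'v, 'r::zero, 'h) phdata \<Rightarrow> 'v \<Rightarrow> ('v \<Rightarrow> 'r) \<Rightarrow> 'v \<Rightarrow> 'r" where
  "conj_act D w c = (\<lambda>t. if t \<in> Tgrp D
      then c (inv\<^bsub>W1g D\<^esub> w \<otimes>\<^bsub>W1g D\<^esub> t \<otimes>\<^bsub>W1g D\<^esub> w) else 0)"

text \<open>Multiplication of an element of R[T] by a group element t0 of T.\<close>
definition transl :: "('w, 'v, 'r::zero, 'h) phdata \<Rightarrow> 'v \<Rightarrow> ('v \<Rightarrow> 'r) \<Rightarrow> 'v \<Rightarrow> 'r" where
  "transl D t0 c = (\<lambda>t. if t \<in> Tgrp D then c (inv\<^bsub>W1g D\<^esub> t0 \<otimes>\<^bsub>W1g D\<^esub> t) else 0)"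

definition emb :: "('w, 'v, 'r::zero, 'h::semiring_0) phdata \<Rightarrow> ('v \<Rightarrow> 'r) \<Rightarrow> 'h" where
  "emb D c = (\<Sum>t\<in>{t. c t \<noteq> 0}. io D (c t) * Tb D t)"

definition hecke_params :: "('w, 'v, 'r::zero, 'h) phdata \<Rightarrow> bool" where
  "hecke_params D \<longleftrightarrow> (\<forall>s\<in>Sg D. rt_elem D (bp D s)) \<and>
     (\<forall>s\<in>Sg D. \<forall>t\<in>Sg D. \<forall>w\<in>carrier (W1g D).
        s \<otimes>\<^bsub>Wg D\<^esub> prj D w = prj D w \<otimes>\<^bsub>Wg D\<^esub> t \<longrightarrow>
        ap D s = ap D t \<and>
        transl D (nl D s \<otimes>\<^bsub>W1g D\<^esub> w \<otimes>\<^bsub>W1g D\<^esub> inv\<^bsub>W1g D\<^esub> (nl D t)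
                    \<otimes>\<^bsub>W1g D\<^esub> inv\<^bsub>W1g D\<^esub> w) (conj_act D w (bp D t)) = bp D s)"

text \<open>H is an R-algebra (via the central ring map io), free as R-module on
  {T_w : w in W^(1)}, with the braid and quadratic relations.  These data
  determine H = H^(1)_R(a,b) up to isomorphism.\<close>
definition generic_hecke ::
  "('w, 'v, 'r::comm_ring_1, 'h::ring_1) phdata \<Rightarrow> bool" where
  "generic_hecke D \<longleftrightarrow> pro_p_coxeter D \<and> hecke_params D \<and>
     io D 1 = 1 \<and> (\<forall>x y. io D (x + y) = io D x + io D y) \<and>
     (\<forall>x y. io D (x * y) = io D x * io D y) \<and>
     (\<forall>x h. io D x * h = h * io D x) \<and>
     (\<forall>h. \<exists>!c. finite {w. c w \<noteq> 0} \<and> {w. c w \<noteq> 0} \<subseteq> carrier (W1g D) \<and>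
              h = (\<Sum>w\<in>{w. c w \<noteq> 0}. io D (c w) * Tb D w)) \<and>
     (\<forall>w\<in>carrier (W1g D). \<forall>w'\<in>carrier (W1g D).
        len1 D (w \<otimes>\<^bsub>W1g D\<^esub> w') = len1 D w + len1 D w' \<longrightarrow>
        Tb D (w \<otimes>\<^bsub>W1g D\<^esub> w') = Tb D w * Tb D w') \<and>
     (\<forall>s\<in>Sg D. Tb D (nl D s) * Tb D (nl D s) =
        io D (ap D s) * Tb D (nl D s \<otimes>\<^bsub>W1g D\<^esub> nl D s) + Tb D (nl D s) * emb D (bp D s))"

definition sqrt_choice :: "('w, 'v, 'r::comm_ring_1, 'h) phdata \<Rightarrow> bool" where
  "sqrt_choice D \<longleftrightarrow> (\<forall>s\<in>Sg D. (\<exists>y. ap D s * y = 1) \<and> sq D s * sq D s = ap D s) \<and>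
     (\<forall>s\<in>Sg D. \<forall>t\<in>Sg D. \<forall>x\<in>carrier (Wg D).
        t = inv\<^bsub>Wg D\<^esub> x \<otimes>\<^bsub>Wg D\<^esub> s \<otimes>\<^bsub>Wg D\<^esub> x \<longrightarrow> sq D s = sq D t)"

definition rinv :: "'r::comm_ring_1 \<Rightarrow> 'r" where
  "rinv x = (THE y. x * y = 1)"

definition sqrtH :: "('w, 'v, 'r, 'h) phdata \<Rightarrow> 'w \<Rightarrow> 'r" where
  "sqrtH D H = sq D (SOME s. s \<in> Sg D \<and>
      (\<exists>x\<in>carrier (Wg D). H = x \<otimes>\<^bsub>Wg D\<^esub> s \<otimes>\<^bsub>Wg D\<^esub> inv\<^bsub>Wg D\<^esub> x))"

definition Lbar :: "('w, 'v, 'r::comm_ring_1, 'h) phdata \<Rightarrow> 'v \<Rightarrow> 'r" where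
  "Lbar D w = (\<Prod>H\<in>sep1 (Wg D) (Sg D) (aff_part D (prj D w)). sqrtH D H)"

definition OR_signs :: "('w, 'v, 'r, 'h) phdata \<Rightarrow> ('w \<Rightarrow> 'w \<Rightarrow> int) \<Rightarrow> bool" where
  "OR_signs D o0 \<longleftrightarrow> (\<forall>v\<in>Waf D. \<forall>s\<in>Sg D. o0 v s = 1 \<or> o0 v s = -1)"

definition OR1 :: "('w, 'v, 'r, 'h) phdata \<Rightarrow> ('w \<Rightarrow> 'w \<Rightarrow> int) \<Rightarrow> bool" where
  "OR1 D o0 \<longleftrightarrow> (\<forall>v\<in>Waf D. \<forall>s\<in>Sg D. o0 (v \<otimes>\<^bsub>Wg D\<^esub> s) s = - o0 v s)"

definition gallery_signs ::
  "('w, 'v, 'r, 'h) phdata \<Rightarrow> ('w \<Rightarrow> 'w \<Rightarrow> int) \<Rightarrow> 'w \<Rightarrow> 'w \<Rightarrow> 'w \<Rightarrow> nat \<Rightarrow> int list" where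
  "gallery_signs D o0 v s t m = map (\<lambda>i. o0 (v \<otimes>\<^bsub>Wg D\<^esub> wprod (Wg D) (take i (alt_word s t m)))
       (alt_word s t m ! i)) [0..<m]"

definition OR2 :: "('w, 'v, 'r, 'h) phdata \<Rightarrow> ('w \<Rightarrow> 'w \<Rightarrow> int) \<Rightarrow> bool" where
  "OR2 D o0 \<longleftrightarrow> (\<forall>v\<in>Waf D. \<forall>s\<in>Sg D. \<forall>t\<in>Sg D. cox_m (Wg D) s t > 0 \<longrightarrow>
     (let m = cox_m (Wg D) s t; q1 = gallery_signs D o0 v s t m; q2 = gallery_signs D o0 v t s m
      in \<exists>k\<le>m. (q1 = replicate k 1 @ replicate (m - k) (-1) \<and>
                  q2 = replicate (m - k) (-1) @ replicate k 1) \<or>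
                 (q1 = replicate (m - k) (-1) @ replicate k 1 \<and>
                  q2 = replicate k 1 @ replicate (m - k) (-1))))"

definition orientation :: "('w, 'v, 'r, 'h) phdata \<Rightarrow> ('v \<Rightarrow> 'w \<Rightarrow> int) \<Rightarrow> bool" where
  "orientation D ori \<longleftrightarrow> (\<exists>o0. OR_signs D o0 \<and> OR1 D o0 \<and> OR2 D o0 \<and>
     (\<forall>w\<in>carrier (W1g D). \<forall>s\<in>Sg D.
        ori w s = o0 (aff_part D (prj D w))
                   (om_part D (prj D w) \<otimes>\<^bsub>Wg D\<^esub> s \<otimes>\<^bsub>Wg D\<^esub> inv\<^bsub>Wg D\<^esub> (om_part D (prj D w)))))"

definition lift :: "('w, 'v, 'r, 'h) phdata \<Rightarrow> 'w \<Rightarrow> 'v" where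
  "lift D x = (SOME y. y \<in> carrier (W1g D) \<and> prj D y = x)"

text \<open>Right action (o . w)(w', s) = o(w w', s); for x in W via any lift.\<close>
definition orient_act :: "('w, 'v, 'r, 'h) phdata \<Rightarrow> ('v \<Rightarrow> 'w \<Rightarrow> int) \<Rightarrow> 'w \<Rightarrow> 'v \<Rightarrow> 'w \<Rightarrow> int" where
  "orient_act D ori x = (\<lambda>w' s. ori (lift D x \<otimes>\<^bsub>W1g D\<^esub> w') s)"

definition o1H :: "('w, 'v, 'r, 'h) phdata \<Rightarrow> ('v \<Rightarrow> 'w \<Rightarrow> int) \<Rightarrow> 'w \<Rightarrow> int" where
  "o1H D ori H = (let p = (SOME p. fst p \<in> Waf D \<and> snd p \<in> Sg D \<and>
        fst p \<otimes>\<^bsub>Wg D\<^esub> snd p \<otimes>\<^bsub>Wg D\<^esub> inv\<^bsub>Wg D\<^esub> (fst p) = H \<and>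
        H \<notin> sep1 (Wg D) (Sg D) (fst p))
     in ori (lift D (fst p)) (snd p))"

definition adjacent :: "('w, 'v, 'r, 'h) phdata \<Rightarrow> ('v \<Rightarrow> 'w \<Rightarrow> int) \<Rightarrow> ('v \<Rightarrow> 'w \<Rightarrow> int) \<Rightarrow> bool" where
  "adjacent D ori ori' \<longleftrightarrow> (\<forall>H\<in>hyperplanes (Wg D) (Waf D) (Sg D). o1H D ori H \<noteq> o1H D ori' H \<longrightarrow>
      (\<forall>w\<in>carrier (W1g D). \<forall>s\<in>Sg D. orient_act D ori H w s = ori' w s))"

definition bern_factor ::
  "('w, 'v, 'r::zero, 'h::ring_1) phdata \<Rightarrow> ('v \<Rightarrow> 'w \<Rightarrow> int) \<Rightarrow> 'w list \<Rightarrow> nat \<Rightarrow> 'h" where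
  "bern_factor D ori ss i = (if ori (wprod (W1g D) (map (nl D) (take i ss))) (ss ! i) = 1
      then Tb D (nl D (ss ! i)) else Tb D (nl D (ss ! i)) - emb D (bp D (ss ! i)))"

definition hat_theta :: "('w, 'v, 'r::zero, 'h::ring_1) phdata \<Rightarrow> ('v \<Rightarrow> 'w \<Rightarrow> int) \<Rightarrow> 'v \<Rightarrow> 'h" where
  "hat_theta D ori w = (SOME x. \<exists>ss u. ss \<in> lists (Sg D) \<and> length ss = len1 D w \<and> u \<in> Om1 D \<and>
      w = wprod (W1g D) (map (nl D) ss) \<otimes>\<^bsub>W1g D\<^esub> u \<and>
      x = prod_list (map (bern_factor D ori ss) [0..<length ss]) * Tb D u)"

definition tilde_theta ::
  "('w, 'v, 'r::comm_ring_1, 'h::ring_1) phdata \<Rightarrow> ('v \<Rightarrow> 'w \<Rightarrow> int) \<Rightarrow> 'v \<Rightarrow> 'h" where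
  "tilde_theta D ori w = io D (rinv (Lbar D w)) * hat_theta D ori w"

definition Xi :: "('w, 'v, 'r::comm_ring_1, 'h::ring_1) phdata \<Rightarrow> ('v \<Rightarrow> 'w \<Rightarrow> int) \<Rightarrow> 'w \<Rightarrow> 'h" where
  "Xi D ori H = (SOME x. \<exists>w s. w \<in> carrier (W1g D) \<and> s \<in> Sg D \<and>
      prj D (w \<otimes>\<^bsub>W1g D\<^esub> nl D s \<otimes>\<^bsub>W1g D\<^esub> inv\<^bsub>W1g D\<^esub> w) = H \<and>
      x = io D (rinv (sq D s)) * emb D (conj_act D w (bp D s)) *
          tilde_theta D ori (w \<otimes>\<^bsub>W1g D\<^esub> inv\<^bsub>W1g D\<^esub> (nl D s) \<otimes>\<^bsub>W1g D\<^esub> inv\<^bsub>W1g D\<^esub> w))"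

end

theory Submission
  imports Defs "HOL-Library.Z2"
begin

text \<open>
  Along a word s_1 ... s_r starting at a chamber v one multiplies the normalized factors
  sqrt(a)^-1 T_(n_s) or sqrt(a)^-1 (T_(n_s) - b_s), according to the signs met on the way. The
  quadratic relation makes the two factors inverse to each other up to T_(n_s^2), and (OR2) makes the
  product compatible with the braid relations; hence, by the Coxeter presentation, the product depends
  only on the element of the pro-p group that the word represents, whether or not the word is reduced.
  This yields a cocycle
  Theta_v(w w') = Theta_v(w) Theta_(v pi(w))(w') extending the normalized Bernstein map.
  The theorem follows by telescoping along a reduced word: at a hyperplane of disagreement the two
  factors differ by a multiple of sqrt(a)^-1 b_s, and adjacency turns the left factor
  Theta'(y) into Theta'(y n_s^-1 y^-1) Theta(y n_s) by the cocycle rule.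
\<close>

text \<open>The obstacle is the braid move: a braid gallery that carries both signs is not a product
  of basis elements along a reduced word. What helps is that \<open>factor (-1) s\<close> is the
  inverse of the normalized basis element at the inverse of n_s. By (OR2) the minus signs fill one
  block at the beginning of one gallery and one block at the end of the other. Moving both blocks
  across the equation as inverses leaves, on each side, a product of basis elements along an
  alternating word of length m, hence a single normalized T_w, and the claim becomes an identity in
  the pro-p group. The base chamber is a variable of the cocycle because adjacency is a statement
  about translates: from the chamber H v the orientation o' shows the signs that o shows from v.
  Crossing weights of galleries serve twice. With values in the field of two elements they identify
  reduced words with galleries that meet no wall twice; with an orientation as weight they show that
  the sign o(1,H) is well defined.\<close>

lemma wprod_Nil [simp]: "wprod G [] = \<one>\<^bsub>G\<^esub>"
  by (simp add: wprod_def)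

lemma wprod_Cons [simp]: "wprod G (x # xs) = x \<otimes>\<^bsub>G\<^esub> wprod G xs"
  by (simp add: wprod_def)

lemma (in monoid) wprod_closed [simp]: "set xs \<subseteq> carrier G \<Longrightarrow> wprod G xs \<in> carrier G"
  by (induction xs) auto

lemma (in monoid) wprod_append:
  "set xs \<subseteq> carrier G \<Longrightarrow> set ys \<subseteq> carrier G \<Longrightarrow> wprod G (xs @ ys) = wprod G xs \<otimes> wprod G ys"
  by (induction xs) (auto simp: m_assoc)

section \<open>Alternating words\<close>

lemma alt_word_0 [simp]: "alt_word s t 0 = []"
  by (simp add: alt_word_def)

lemma alt_word_Suc: "alt_word s t (Suc k) = s # alt_word t s k"
  by (simp add: alt_word_def map_upt_Suc del: upt_Suc)

lemma length_alt_word [simp]: "length (alt_word s t k) = k"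
  by (simp add: alt_word_def)

lemma nth_alt_word [simp]: "i < k \<Longrightarrow> alt_word s t k ! i = (if even i then s else t)"
  by (simp add: alt_word_def)

lemma set_alt_word: "set (alt_word s t k) \<subseteq> {s, t}"
  by (auto simp: alt_word_def)

lemma alt_word_lists: "s \<in> S \<Longrightarrow> t \<in> S \<Longrightarrow> alt_word s t k \<in> lists S"
  using set_alt_word[of s t k] by (auto simp: in_lists_conv_set)

lemma rev_alt_word: "rev (alt_word s t k) = (if even k then alt_word t s k else alt_word s t k)"
  by (rule nth_equalityI) (auto simp: rev_nth)

lemma map_alt_word: "map f (alt_word s t k) = alt_word (f s) (f t) k"
  by (rule nth_equalityI) auto

text \<open>This splits the relator (st)^m of the Coxeter presentation into one side of the braid
  relation and the inverse of the other side.\<close>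

lemma alt_word_double: "alt_word s t (2 * m) = alt_word s t m @ rev (alt_word t s m)"
  by (rule nth_equalityI) (auto simp: nth_append rev_nth)

lemma alt_word_add:
  "alt_word s t (j + k) = alt_word s t j @ (if even j then alt_word s t k else alt_word t s k)"
  by (rule nth_equalityI) (auto simp: nth_append)

lemma map2_replicate: "length xs = k \<Longrightarrow> map2 f (replicate k c) xs = map (f c) xs"
  by (induction xs arbitrary: k) auto

lemma take_alt_word: "i \<le> k \<Longrightarrow> take i (alt_word s t k) = alt_word s t i"
  by (rule nth_equalityI) auto

lemma drop_alt_word:
  "i \<le> k \<Longrightarrow> drop i (alt_word s t k) = (if even i then alt_word s t (k - i) else alt_word t s (k - i))"
  by (rule nth_equalityI) auto

subsection \<open>Galleries and their walls\<close>

text \<open>The walls met by the gallery that starts at v: the conjugate of s by v is the wall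
  between v and its neighbour v s.\<close>

primrec refls :: "('a, 'b) monoid_scheme \<Rightarrow> 'a \<Rightarrow> 'a list \<Rightarrow> 'a list" where
  "refls G v [] = []"
| "refls G v (s # xs) = (v \<otimes>\<^bsub>G\<^esub> s \<otimes>\<^bsub>G\<^esub> inv\<^bsub>G\<^esub> v) # refls G (v \<otimes>\<^bsub>G\<^esub> s) xs"

primrec signs :: "('a, 'b) monoid_scheme \<Rightarrow> ('a \<Rightarrow> 'a \<Rightarrow> 'c) \<Rightarrow> 'a \<Rightarrow> 'a list \<Rightarrow> 'c list" where
  "signs G f v [] = []"
| "signs G f v (s # xs) = f v s # signs G f (v \<otimes>\<^bsub>G\<^esub> s) xs"

text \<open>Each passage through H is counted with the value of f at the panel being crossed. The
  weights used later are the constant 1 in \<open>bit\<close>, which gives the parity of the number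
  of passages, and orientations, which give integers.\<close>

definition crossing :: "('a, 'b) monoid_scheme \<Rightarrow> ('a \<Rightarrow> 'a \<Rightarrow> 'c) \<Rightarrow> 'a \<Rightarrow> 'a \<Rightarrow> 'a list \<Rightarrow> 'c::comm_monoid_add" where
  "crossing G f H v xs = (\<Sum>(r, e)\<leftarrow>zip (refls G v xs) (signs G f v xs). if r = H then e else 0)"

lemma length_refls [simp]: "length (refls G v xs) = length xs"
  by (induction xs arbitrary: v) auto

lemma length_signs [simp]: "length (signs G f v xs) = length xs"
  by (induction xs arbitrary: v) auto

lemma crossing_Nil [simp]: "crossing G f H v [] = 0"
  by (simp add: crossing_def)

lemma crossing_Cons [simp]: "crossing G f H v (s # xs) =
    (if v \<otimes>\<^bsub>G\<^esub> s \<otimes>\<^bsub>G\<^esub> inv\<^bsub>G\<^esub> v = H then f v s else 0) + crossing G f H (v \<otimes>\<^bsub>G\<^esub> s) xs"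
  by (simp add: crossing_def)

lemma crossing_eq_0: "H \<notin> set (refls G v xs) \<Longrightarrow> crossing G f H v xs = 0"
  by (induction xs arbitrary: v) auto

context group
begin

lemma conj_eq_iff: "\<lbrakk>v \<in> carrier G; x \<in> carrier G; y \<in> carrier G\<rbrakk> \<Longrightarrow>
    v \<otimes> x \<otimes> inv v = v \<otimes> y \<otimes> inv v \<longleftrightarrow> x = y"
  by simp

lemma refls_append: "\<lbrakk>v \<in> carrier G; set xs \<subseteq> carrier G; set ys \<subseteq> carrier G\<rbrakk> \<Longrightarrow>
    refls G v (xs @ ys) = refls G v xs @ refls G (v \<otimes> wprod G xs) ys"
  by (induction xs arbitrary: v) (auto simp: m_assoc)

lemma signs_append: "\<lbrakk>v \<in> carrier G; set xs \<subseteq> carrier G; set ys \<subseteq> carrier G\<rbrakk> \<Longrightarrow>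
    signs G f v (xs @ ys) = signs G f v xs @ signs G f (v \<otimes> wprod G xs) ys"
  by (induction xs arbitrary: v) (auto simp: m_assoc)

lemma crossing_append: "\<lbrakk>v \<in> carrier G; set xs \<subseteq> carrier G; set ys \<subseteq> carrier G\<rbrakk> \<Longrightarrow>
    crossing G f H v (xs @ ys) = crossing G f H v xs + crossing G f H (v \<otimes> wprod G xs) ys"
  by (simp add: crossing_def refls_append signs_append)

lemma refls_nth: "\<lbrakk>v \<in> carrier G; set xs \<subseteq> carrier G; i < length xs\<rbrakk> \<Longrightarrow>
    refls G v xs ! i = v \<otimes> wprod G (take i xs) \<otimes> xs ! i \<otimes> inv (v \<otimes> wprod G (take i xs))"
proof (induction xs arbitrary: v i)
  case (Cons s xs)
  show ?case
  proof (cases i)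
    case (Suc j)
    have "set (take j xs) \<subseteq> carrier G"
      using Cons.prems by (auto dest: in_set_takeD)
    then show ?thesis
      using Cons Suc by (simp add: m_assoc)
  qed (use Cons.prems in simp)
qed simp

lemma signs_nth: "\<lbrakk>v \<in> carrier G; set xs \<subseteq> carrier G; i < length xs\<rbrakk> \<Longrightarrow>
    signs G f v xs ! i = f (v \<otimes> wprod G (take i xs)) (xs ! i)"
proof (induction xs arbitrary: v i)
  case (Cons s xs)
  show ?case
  proof (cases i)
    case (Suc j)
    have "set (take j xs) \<subseteq> carrier G"
      using Cons.prems by (auto dest: in_set_takeD)
    then show ?thesis
      using Cons Suc by (simp add: m_assoc)
  qed (use Cons.prems in simp)
qed simp

lemma refls_closed: "\<lbrakk>v \<in> carrier G; set xs \<subseteq> carrier G\<rbrakk> \<Longrightarrow> set (refls G v xs) \<subseteq> carrier G"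
  by (induction xs arbitrary: v) auto

lemma refls_conj: "\<lbrakk>g \<in> carrier G; v \<in> carrier G; set xs \<subseteq> carrier G\<rbrakk> \<Longrightarrow>
    refls G (g \<otimes> v) xs = map (\<lambda>r. g \<otimes> r \<otimes> inv g) (refls G v xs)"
proof (induction xs arbitrary: v)
  case (Cons s xs)
  then have "refls G (g \<otimes> (v \<otimes> s)) xs = map (\<lambda>r. g \<otimes> r \<otimes> inv g) (refls G (v \<otimes> s) xs)"
    by simp
  with Cons.prems show ?case
    by (simp add: m_assoc inv_mult_group)
qed simp

lemma distinct_refls_base:
  assumes "v \<in> carrier G" "set xs \<subseteq> carrier G"
  shows "distinct (refls G v xs) \<longleftrightarrow> distinct (refls G \<one> xs)"
proof -
  have "inj_on (\<lambda>r. v \<otimes> r \<otimes> inv v) (set (refls G \<one> xs))"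
    using refls_closed[OF one_closed assms(2)] assms(1) by (auto simp: inj_on_def subset_iff)
  moreover have "refls G v xs = map (\<lambda>r. v \<otimes> r \<otimes> inv v) (refls G \<one> xs)"
    using refls_conj[of v \<one> xs] assms by simp
  ultimately show ?thesis
    by (metis distinct_map)
qed

lemma wprod_alt_even:
  assumes "s \<in> carrier G" "t \<in> carrier G"
  shows "wprod G (alt_word s t (2 * i)) = (s \<otimes> t) [^] i"
proof (induction i)
  case (Suc i)
  have "alt_word s t (2 * Suc i) = s # t # alt_word s t (2 * i)"
    by (simp add: alt_word_Suc)
  moreover have "(s \<otimes> t) [^] Suc i = (s \<otimes> t) \<otimes> (s \<otimes> t) [^] i"
    using assms by (intro nat_pow_Suc2) simp
  ultimately show ?case
    using Suc assms by (simp add: m_assoc del: nat_pow_Suc)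
qed simp

end

lemma rev_in_lists [simp]: "rev xs \<in> lists S \<longleftrightarrow> xs \<in> lists S"
  by auto

section \<open>Coxeter groups: rank-two galleries and the presentation\<close>

locale coxeter = group G for G (structure) +
  fixes Wa S
  assumes cox: "coxeter_system G Wa S"
begin

lemma Wa_subgroup: "subgroup Wa G"
  and S_Wa: "S \<subseteq> Wa"
  and S_sq: "s \<in> S \<Longrightarrow> s \<otimes> s = \<one>"
  and Wa_words: "Wa = wprod G ` lists S"
  and cox_equivI: "\<lbrakk>xs \<in> lists S; ys \<in> lists S; wprod G xs = wprod G ys\<rbrakk> \<Longrightarrow> cox_equiv G S xs ys"
  using cox unfolding coxeter_system_def by blast+

lemma Wa_carrier: "v \<in> Wa \<Longrightarrow> v \<in> carrier G"
  using Wa_subgroup by (rule subgroup.mem_carrier)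

lemma S_carrier [simp]: "s \<in> S \<Longrightarrow> s \<in> carrier G"
  using S_Wa Wa_carrier by blast

lemma lists_carrier [simp]: "xs \<in> lists S \<Longrightarrow> set xs \<subseteq> carrier G"
  by auto

lemma wprod_lists_Wa: "xs \<in> lists S \<Longrightarrow> wprod G xs \<in> Wa"
  using Wa_words by blast

lemma wprod_lists [simp]: "xs \<in> lists S \<Longrightarrow> wprod G xs \<in> carrier G"
  by simp

lemma S_inv: "s \<in> S \<Longrightarrow> inv s = s"
  using S_sq inv_equality S_carrier by blast

lemma inv_wprod: "xs \<in> lists S \<Longrightarrow> inv (wprod G xs) = wprod G (rev xs)"
proof (induction xs)
  case (Cons s xs)
  then have "rev xs \<in> lists S" "s \<in> S"
    by auto
  then show ?case
    using Cons by (auto simp: inv_mult_group wprod_append S_inv)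
qed simp

lemma wprod_rev_cancel: "xs \<in> lists S \<Longrightarrow> wprod G (xs @ rev xs) = \<one>"
  using inv_wprod[of xs, symmetric] by (simp add: wprod_append)

lemma cox_m_pow: "cox_m G s t > 0 \<Longrightarrow> (s \<otimes> t) [^] cox_m G s t = \<one>"
  unfolding cox_m_def by (auto split: if_splits intro: LeastI2_ex)

lemma cox_m_min: "0 < n \<Longrightarrow> n < cox_m G s t \<Longrightarrow> (s \<otimes> t) [^] n \<noteq> \<one>"
  unfolding cox_m_def by (auto split: if_splits dest: not_less_Least)

lemma cox_m_commute:
  assumes "s \<in> S" "t \<in> S"
  shows "cox_m G t s = cox_m G s t"
proof -
  have "inv (s \<otimes> t) = t \<otimes> s"
    using assms by (simp add: inv_mult_group S_inv)
  then have "(t \<otimes> s) [^] n = inv ((s \<otimes> t) [^] n)" for n :: nat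
    using assms by (simp add: nat_pow_inv[symmetric])
  moreover have "inv x = \<one> \<longleftrightarrow> x = \<one>" if "x \<in> carrier G" for x
    using that by (metis inv_inv inv_one)
  ultimately have "((t \<otimes> s) [^] n = \<one>) = ((s \<otimes> t) [^] n = \<one>)" for n :: nat
    using assms by simp
  then show ?thesis
    by (simp only: cox_m_def)
qed

lemma take_lists: "xs \<in> lists S \<Longrightarrow> take i xs \<in> lists S"
  by (auto dest: in_set_takeD)

text \<open>The wall is the conjugate by v of a palindrome: i letters, the letter at index i, and
  the i letters reversed. Together these form the alternating word of length 2i+1.\<close>

lemma refls_alt:
  assumes "s \<in> S" "t \<in> S" "v \<in> carrier G" "i < k"
  shows "refls G v (alt_word s t k) ! i = v \<otimes> ((s \<otimes> t) [^] i \<otimes> s) \<otimes> inv v"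
proof -
  let ?a = "alt_word s t i" and ?x = "if even i then s else t"
  have mem: "?a \<in> lists S" "rev ?a \<in> lists S" "?x \<in> S" "alt_word s t k \<in> lists S"
    "alt_word s t (2 * i) \<in> lists S"
    using assms alt_word_lists[of s S t] by simp_all
  have take: "take i (alt_word s t k) = ?a"
    using assms(4) by (intro nth_equalityI) auto
  have "refls G v (alt_word s t k) ! i = v \<otimes> (wprod G ?a \<otimes> ?x \<otimes> inv (wprod G ?a)) \<otimes> inv v"
    using assms mem by (simp add: refls_nth take m_assoc inv_mult_group)
  also have "wprod G ?a \<otimes> ?x \<otimes> inv (wprod G ?a) = wprod G (?a @ [?x] @ rev ?a)"
    using mem by (simp add: wprod_append inv_wprod m_assoc)
  also have "?a @ [?x] @ rev ?a = alt_word s t (2 * i) @ [s]"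
    by (rule nth_equalityI) (auto simp: nth_append rev_nth nth_Cons')
  also have "wprod G \<dots> = (s \<otimes> t) [^] i \<otimes> s"
    using assms mem by (simp add: wprod_append wprod_alt_even)
  finally show ?thesis .
qed

text \<open>The two galleries of length m around a rank-two residue meet the same walls in opposite
  order, because (st)^m = 1 gives (st)^(m-1-i) s = (ts)^i t.\<close>

lemma refls_alt_rev:
  assumes "s \<in> S" "t \<in> S" "v \<in> carrier G" "cox_m G s t > 0"
  shows "refls G v (alt_word t s (cox_m G s t)) = rev (refls G v (alt_word s t (cox_m G s t)))"
proof (rule nth_equalityI, goal_cases)
  case (2 i)
  define m where "m = cox_m G s t"
  have i: "i < m"
    using 2 by (simp add: m_def)
  define p where "p = s \<otimes> t"
  have p: "p \<in> carrier G" "inv p = t \<otimes> s"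
    using assms by (auto simp: p_def inv_mult_group S_inv)
  have "p [^] (m - Suc i) \<otimes> p [^] Suc i = \<one>"
    using cox_m_pow[OF assms(4)] i p by (subst nat_pow_mult) (simp_all add: m_def p_def del: nat_pow_Suc)
  then have "p [^] (m - Suc i) = inv (p [^] Suc i)"
    using p by (metis inv_equality nat_pow_closed)
  also have "\<dots> = (t \<otimes> s) [^] Suc i"
    using p nat_pow_inv[of p "Suc i"] by simp
  also have "\<dots> = (t \<otimes> s) [^] i \<otimes> (t \<otimes> s)"
    by simp
  finally have "p [^] (m - Suc i) \<otimes> s = (t \<otimes> s) [^] i \<otimes> t"
    using assms by (simp add: m_assoc S_sq)
  then show ?case
    using i assms by (simp add: rev_nth refls_alt m_def p_def)
qed simp

text \<open>A wall repeated at i < j forces (st)^(j-i) = 1 with 0 < j-i < m. When st has infinite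
  order, the value 0 of \<open>cox_m\<close> leaves only the empty word.\<close>

lemma distinct_refls_alt:
  assumes "s \<in> S" "t \<in> S" "v \<in> carrier G" "k \<le> cox_m G s t"
  shows "distinct (refls G v (alt_word s t k))"
  unfolding distinct_conv_nth
proof (intro allI impI, goal_cases)
  case (1 i j)
  have *: "refls G v (alt_word s t k) ! i \<noteq> refls G v (alt_word s t k) ! j" if "i < j" "j < k" for i j
  proof
    define p where "p = s \<otimes> t"
    have p: "p \<in> carrier G"
      using assms by (simp add: p_def)
    assume "refls G v (alt_word s t k) ! i = refls G v (alt_word s t k) ! j"
    then have "p [^] i = p [^] j"
      using assms that p by (simp add: refls_alt p_def)
    also have "p [^] j = p [^] i \<otimes> p [^] (j - i)"
      using that p by (simp add: nat_pow_mult)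
    finally have "p [^] (j - i) = \<one>"
      using p by simp
    then show False
      using cox_m_min[of "j - i" s t] that assms by (simp add: p_def)
  qed
  show ?case
    using 1 *[of i j] *[of j i] by (cases i j rule: linorder_cases) auto
qed

text \<open>These conditions make \<open>crossing\<close> invariant under the Coxeter moves: a step
  and its reverse cancel at their common wall, and the reversed weight sequences match the reversed
  wall sequences of a braid pair. The constant 1 in \<open>bit\<close> qualifies because 1 = -1
  there.\<close>

definition reversal_weight :: "('a \<Rightarrow> 'a \<Rightarrow> 'c::ab_group_add) \<Rightarrow> bool" where
  "reversal_weight f \<longleftrightarrow> (\<forall>v\<in>carrier G. \<forall>s\<in>S. f (v \<otimes> s) s = - f v s) \<and>
     (\<forall>v\<in>carrier G. \<forall>s\<in>S. \<forall>t\<in>S. cox_m G s t > 0 \<longrightarrow>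
        signs G f v (alt_word t s (cox_m G s t)) = rev (signs G f v (alt_word s t (cox_m G s t))))"

lemma crossing_rev_cancel:
  assumes "reversal_weight f"
  shows "v \<in> carrier G \<Longrightarrow> xs \<in> lists S \<Longrightarrow> crossing G f H v (xs @ rev xs) = 0"
proof (induction xs arbitrary: v)
  case (Cons s xs)
  then have mem: "xs @ rev xs \<in> lists S" "s \<in> S" "v \<otimes> s \<in> carrier G" "xs \<in> lists S" "[s] \<in> lists S" "v \<in> carrier G"
    by auto
  have "crossing G f H (v \<otimes> s) ((xs @ rev xs) @ [s]) = (if v \<otimes> s \<otimes> inv v = H then - f v s else 0)"
  proof -
    have "v \<otimes> s \<otimes> s \<otimes> inv (v \<otimes> s) = v \<otimes> (s \<otimes> s) \<otimes> s \<otimes> inv v"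
      using mem by (simp add: inv_mult_group S_inv m_assoc)
    then have "v \<otimes> s \<otimes> s \<otimes> inv (v \<otimes> s) = v \<otimes> s \<otimes> inv v"
      using mem by (simp add: S_sq)
    moreover have "crossing G f H (v \<otimes> s) ((xs @ rev xs) @ [s]) = crossing G f H (v \<otimes> s) [s]"
      using Cons.IH mem by (subst crossing_append) (simp_all add: wprod_rev_cancel)
    moreover have "f (v \<otimes> s) s = - f v s"
      using assms mem by (simp add: reversal_weight_def)
    ultimately show ?thesis
      by simp
  qed
  then show ?case
    by simp
qed simp

lemma crossing_alt_swap:
  assumes "reversal_weight f" "s \<in> S" "t \<in> S" "v \<in> carrier G" "cox_m G s t > 0"
  shows "crossing G f H v (alt_word t s (cox_m G s t)) = crossing G f H v (alt_word s t (cox_m G s t))"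
proof -
  have "signs G f v (alt_word t s (cox_m G s t)) = rev (signs G f v (alt_word s t (cox_m G s t)))"
    using assms by (auto simp: reversal_weight_def)
  then show ?thesis
    using assms by (simp add: crossing_def refls_alt_rev zip_rev rev_map[symmetric] sum_list_rev)
qed

lemma wprod_alt_swap:
  assumes "s \<in> S" "t \<in> S" "cox_m G s t > 0"
  shows "wprod G (alt_word t s (cox_m G s t)) = wprod G (alt_word s t (cox_m G s t))"
proof -
  let ?m = "cox_m G s t"
  have mem: "alt_word s t ?m \<in> lists S" "alt_word t s ?m \<in> lists S" "rev (alt_word t s ?m) \<in> lists S"
    using assms alt_word_lists[of s S t] alt_word_lists[of t S s] by simp_all
  have "\<one> = wprod G (alt_word s t (2 * ?m))"
    using assms by (simp add: wprod_alt_even cox_m_pow)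
  also have "\<dots> = wprod G (alt_word s t ?m) \<otimes> inv (wprod G (alt_word t s ?m))"
    using mem by (simp add: alt_word_double wprod_append inv_wprod)
  finally show ?thesis
    using mem by (metis inv_comm inv_equality inv_inv inv_closed wprod_lists)
qed

lemma cox_step_lists: "cox_step G S xs ys \<Longrightarrow> xs \<in> lists S \<longleftrightarrow> ys \<in> lists S"
  by (induction rule: cox_step.induct) (auto dest: subsetD[OF set_alt_word])

text \<open>The form of the Coxeter presentation used for every well-definedness argument below:
  relators are replaced by squares and braid pairs. The context clause also supplies the equality of
  products, because both words must lead the suffix to start at the same chamber.\<close>

lemma cox_equiv_induct [consumes 3, case_names refl sym trans append square braid]:
  assumes eq: "wprod G xs = wprod G ys" and xs: "xs \<in> lists S" and ys: "ys \<in> lists S"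
    and refl: "\<And>xs. xs \<in> lists S \<Longrightarrow> P xs xs"
    and sym: "\<And>xs ys. xs \<in> lists S \<Longrightarrow> ys \<in> lists S \<Longrightarrow> P xs ys \<Longrightarrow> P ys xs"
    and trans: "\<And>xs ys zs. xs \<in> lists S \<Longrightarrow> ys \<in> lists S \<Longrightarrow> zs \<in> lists S \<Longrightarrow> P xs ys \<Longrightarrow> P ys zs \<Longrightarrow> P xs zs"
    and append: "\<And>us vs xs ys. us \<in> lists S \<Longrightarrow> vs \<in> lists S \<Longrightarrow> xs \<in> lists S \<Longrightarrow> ys \<in> lists S \<Longrightarrow>
        wprod G xs = wprod G ys \<Longrightarrow> P xs ys \<Longrightarrow> P (us @ xs @ vs) (us @ ys @ vs)"
    and square: "\<And>s. s \<in> S \<Longrightarrow> P [s, s] []"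
    and braid: "\<And>s t. s \<in> S \<Longrightarrow> t \<in> S \<Longrightarrow> s \<noteq> t \<Longrightarrow> cox_m G s t > 0 \<Longrightarrow>
        P (alt_word s t (cox_m G s t)) (alt_word t s (cox_m G s t))"
  shows "P xs ys"
proof -
  have cancel: "P (xs @ rev xs) []" if "xs \<in> lists S" for xs
    using that
  proof (induction xs)
    case (Cons s xs)
    then have "s \<in> S" "xs \<in> lists S"
      by simp_all
    then have mem: "s \<in> S" "[s] \<in> lists S" "xs @ rev xs \<in> lists S" "(s # xs) @ rev (s # xs) \<in> lists S" "[s, s] \<in> lists S"
      by simp_all
    have "P (xs @ rev xs) []"
      using Cons mem by simp
    moreover have "wprod G (xs @ rev xs) = wprod G []"
      using wprod_rev_cancel[OF \<open>xs \<in> lists S\<close>] by simp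
    ultimately have "P ([s] @ (xs @ rev xs) @ [s]) ([s] @ [] @ [s])"
      using append[of "[s]" "[s]" "xs @ rev xs" "[]"] mem by simp
    then have "P ((s # xs) @ rev (s # xs)) [s, s]"
      by simp
    with square[of s] mem trans[of "(s # xs) @ rev (s # xs)" "[s, s]" "[]"] show ?case
      by blast
  qed (use refl in simp)
  have step: "P xs ys" if "cox_step G S xs ys" "xs \<in> lists S" for xs ys
    using that
  proof (induction rule: cox_step.induct)
    case (sq_rel s u v)
    have "P (u @ [s, s] @ v) (u @ [] @ v)"
      using sq_rel by (intro append square) (auto simp: S_sq)
    then show ?case
      by simp
  next
    case (braid_rel s t u v)
    let ?m = "cox_m G s t"
    let ?a = "alt_word s t ?m" and ?b = "alt_word t s ?m"
    have mem: "?a \<in> lists S" "?b \<in> lists S" "rev ?b \<in> lists S" "u \<in> lists S" "v \<in> lists S" "[] \<in> lists S"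
      using braid_rel alt_word_lists[of s S t] alt_word_lists[of t S s] by simp_all
    \<comment> \<open>For s = t the two words coincide, so reflexivity covers this case of the
      relator.\<close>
    have "P ?a ?b"
      using braid[of s t] braid_rel refl mem by (cases "s = t") auto
    \<comment> \<open>Appending the reverse of \<open>?b\<close> turns the braid pair into the
      relator on one side and a cancelling word on the other.\<close>
    then have "P ([] @ ?a @ rev ?b) ([] @ ?b @ rev ?b)"
      using mem braid_rel by (intro append) (auto simp: wprod_alt_swap)
    moreover have "P (?b @ rev ?b) []"
      by (rule cancel) (rule mem)
    ultimately have "P (?a @ rev ?b) []"
      using mem trans[of "?a @ rev ?b" "?b @ rev ?b" "[]"] by simp
    then have "P (u @ (?a @ rev ?b) @ v) (u @ [] @ v)"
      using mem braid_rel wprod_rev_cancel[of ?b] wprod_alt_swap[of s t]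
      by (intro append) (auto simp: wprod_append)
    then show ?case
      by (simp add: alt_word_double)
  qed
  have "(\<lambda>x y. cox_step G S x y \<or> cox_step G S y x)\<^sup>*\<^sup>* xs ys"
    using cox_equivI[OF xs ys eq] by (simp add: cox_equiv_def)
  then have "ys \<in> lists S \<and> P xs ys"
  proof (induction rule: rtranclp_induct)
    case base
    then show ?case
      using xs refl by blast
  next
    case (step y z)
    then have z: "z \<in> lists S"
      using cox_step_lists by blast
    then have "P y z"
      using step \<open>\<And>ys xs. \<lbrakk>cox_step G S xs ys; xs \<in> lists S\<rbrakk> \<Longrightarrow> P xs ys\<close> sym by blast
    then show ?case
      using step z trans xs by blast
  qed
  then show ?thesis ..
qed

text \<open>For the weight 1 in \<open>bit\<close> this says that the parity of the number of
  passages through H depends only on the two ends of the gallery. The chamber v varies in the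
  induction, since a move inside a word is read from the chamber reached by the prefix.\<close>

lemma crossing_cong:
  assumes f: "reversal_weight f" and "wprod G xs = wprod G ys" "xs \<in> lists S" "ys \<in> lists S" "v \<in> carrier G"
  shows "crossing G f H v xs = crossing G f H v ys"
  using assms(2-5)
proof (induction xs ys arbitrary: v rule: cox_equiv_induct)
  case (append us vs xs ys)
  then show ?case
    by (simp add: crossing_append)
next
  case (square s)
  then show ?case
    using crossing_rev_cancel[OF f, of v "[s]" H] by simp
next
  case (braid s t)
  then show ?case
    using crossing_alt_swap[OF f] by simp
qed auto

section \<open>Parity of crossings, reduced words and separating hyperplanes\<close>

lemma reversal_weight_bit: "reversal_weight (\<lambda>_ _. 1 :: bit)"
proof -
  have "signs G (\<lambda>_ _. 1 :: bit) v xs = replicate (length xs) 1" for v xs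
    by (induction xs arbitrary: v) auto
  then show ?thesis
    by (simp add: reversal_weight_def)
qed

lemma crossing_bit_distinct:
  "distinct (refls G v xs) \<Longrightarrow> crossing G (\<lambda>_ _. 1 :: bit) H v xs = of_bool (H \<in> set (refls G v xs))"
  by (induction xs arbitrary: v) (auto simp: crossing_eq_0)

lemma crossing_bit_mem: "crossing G (\<lambda>_ _. 1 :: bit) H v xs \<noteq> 0 \<Longrightarrow> H \<in> set (refls G v xs)"
  using crossing_eq_0 by metis

lemma exists_reduced: "v \<in> Wa \<Longrightarrow> \<exists>xs. reduced_expr G S xs v"
proof -
  assume "v \<in> Wa"
  then obtain xs where "xs \<in> lists S" "wprod G xs = v"
    using Wa_words by blast
  then have "\<exists>r. \<exists>xs\<in>lists S. length xs = r \<and> wprod G xs = v"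
    by blast
  from LeastI_ex[OF this] show ?thesis
    by (auto simp: reduced_expr_def len_aff_def)
qed

lemma len_aff_le: "xs \<in> lists S \<Longrightarrow> len_aff G S (wprod G xs) \<le> length xs"
  unfolding len_aff_def by (rule Least_le) blast

text \<open>If a wall is met at two positions, both letters can be deleted without changing the
  product, which contradicts minimal length.\<close>

lemma reduced_distinct:
  assumes "reduced_expr G S xs v"
  shows "distinct (refls G \<one> xs)"
  unfolding distinct_conv_nth
proof (intro allI impI, goal_cases)
  case (1 i j)
  have xs: "xs \<in> lists S" "wprod G xs = v" "length xs = len_aff G S v"
    using assms by (auto simp: reduced_expr_def)
  have *: "refls G \<one> xs ! i \<noteq> refls G \<one> xs ! j" if "i < j" "j < length xs" for i j
  proof
    assume eq: "refls G \<one> xs ! i = refls G \<one> xs ! j"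
    have "i < length xs"
      using that by simp
    then obtain a s c' where i: "xs = a @ s # c'" "length a = i"
      by (metis id_take_nth_drop length_take min.absorb4)
    have "j - Suc i < length c'"
      using that i by simp
    then obtain b t c where j: "c' = b @ t # c" "length b = j - Suc i"
      by (metis id_take_nth_drop length_take min.absorb4)
    have mem: "a \<in> lists S" "b \<in> lists S" "c \<in> lists S" "s \<in> S" "t \<in> S"
      using xs(1) i j by simp_all
    define A B where "A = wprod G a" and "B = wprod G b"
    have AB: "A \<in> carrier G" "B \<in> carrier G"
      using mem by (simp_all add: A_def B_def)
    have "refls G \<one> xs ! i = A \<otimes> s \<otimes> inv A"
      using mem AB i j by (simp add: refls_append nth_append A_def[symmetric])
    moreover have "refls G \<one> xs ! j = A \<otimes> s \<otimes> B \<otimes> t \<otimes> inv (A \<otimes> s \<otimes> B)"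
      using mem AB i j that
      by (simp add: refls_append nth_append nth_Cons' A_def[symmetric] B_def[symmetric])
    ultimately have "A \<otimes> s \<otimes> inv A = A \<otimes> s \<otimes> B \<otimes> t \<otimes> inv (A \<otimes> s \<otimes> B)"
      using eq by simp
    moreover have "X \<otimes> t \<otimes> inv X \<otimes> X = X \<otimes> t" if "X \<in> carrier G" for X
      using that mem by (simp add: m_assoc)
    ultimately have "A \<otimes> s \<otimes> inv A \<otimes> (A \<otimes> s \<otimes> B) = A \<otimes> s \<otimes> B \<otimes> t"
      using AB mem by (metis m_closed S_carrier)
    moreover have "A \<otimes> s \<otimes> inv A \<otimes> (A \<otimes> s \<otimes> B) = A \<otimes> (s \<otimes> (inv A \<otimes> A) \<otimes> s) \<otimes> B"
      using AB mem by (simp add: m_assoc del: l_inv) (simp add: m_assoc[symmetric])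
    ultimately have "A \<otimes> B = A \<otimes> s \<otimes> B \<otimes> t"
      using AB mem by (simp add: S_sq)
    then have "wprod G (a @ b @ c) = v"
      using mem xs(2) AB i j by (simp add: wprod_append A_def[symmetric] B_def[symmetric] m_assoc[symmetric])
    then have "len_aff G S v \<le> length (a @ b @ c)"
      using len_aff_le[of "a @ b @ c"] mem by simp
    moreover have "length (a @ b @ c) < length xs"
      using i j by simp
    ultimately show False
      using xs by simp
  qed
  show ?case
    using 1 *[of i j] *[of j i] by (cases i j rule: linorder_cases) auto
qed

text \<open>A reduced gallery meets each of its walls exactly once, which is odd; any other gallery
  with the same ends meets that wall an odd number of times, hence at least once.\<close>

lemma reduced_refls_subset:
  assumes "reduced_expr G S xs v" "ys \<in> lists S" "wprod G ys = v"
  shows "set (refls G \<one> xs) \<subseteq> set (refls G \<one> ys)"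
proof
  fix H
  assume H: "H \<in> set (refls G \<one> xs)"
  have xs: "xs \<in> lists S" "wprod G xs = v"
    using assms by (auto simp: reduced_expr_def)
  have "crossing G (\<lambda>_ _. 1 :: bit) H \<one> ys = crossing G (\<lambda>_ _. 1 :: bit) H \<one> xs"
    using assms xs by (intro crossing_cong reversal_weight_bit) auto
  also have "\<dots> = 1"
    using H reduced_distinct[OF assms(1)] by (simp add: crossing_bit_distinct)
  finally show "H \<in> set (refls G \<one> ys)"
    using crossing_bit_mem[of H \<one> ys] by simp
qed

text \<open>The set \<open>sep1\<close> is a union over all reduced expressions; the inclusion of
  wall sets, used in both directions, shows that they all contribute the same set.\<close>

lemma sep1_eq:
  assumes "reduced_expr G S xs v"
  shows "sep1 G S v = set (refls G \<one> xs)"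
proof -
  have 1: "set (refls G \<one> ys) = {wprod G (take i ys) \<otimes> ys ! i \<otimes> inv (wprod G (take i ys)) | i. i < length ys}"
    if "reduced_expr G S ys v" for ys
  proof -
    have ys: "ys \<in> lists S"
      using that by (auto simp: reduced_expr_def)
    have "wprod G (take i ys) \<in> carrier G" for i
      using take_lists[OF ys] by simp
    then have "refls G \<one> ys ! i = wprod G (take i ys) \<otimes> ys ! i \<otimes> inv (wprod G (take i ys))"
      if "i < length ys" for i
      using that ys by (simp add: refls_nth)
    then show ?thesis
      by (force simp: set_conv_nth)
  qed
  have "sep1 G S v = (\<Union>ys\<in>{ys. reduced_expr G S ys v}. set (refls G \<one> ys))"
    using 1 by (auto simp: sep1_def)
  moreover have "set (refls G \<one> ys) = set (refls G \<one> xs)" if "reduced_expr G S ys v" for ys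
    using reduced_refls_subset[of xs v ys] reduced_refls_subset[of ys v xs] assms that
    by (auto simp: reduced_expr_def)
  ultimately show ?thesis
    using assms by blast
qed

text \<open>By parity every wall of a repetition-free gallery occurs in a reduced gallery with the
  same ends; counting walls bounds its length by the minimal one.\<close>

lemma distinct_reduced:
  assumes "ys \<in> lists S" "distinct (refls G \<one> ys)"
  shows "reduced_expr G S ys (wprod G ys)"
proof -
  obtain xs where xs: "reduced_expr G S xs (wprod G ys)"
    using exists_reduced wprod_lists_Wa assms by blast
  have "H \<in> set (refls G \<one> xs)" if "H \<in> set (refls G \<one> ys)" for H
  proof -
    have "crossing G (\<lambda>_ _. 1 :: bit) H \<one> xs = crossing G (\<lambda>_ _. 1 :: bit) H \<one> ys"
      using assms xs by (intro crossing_cong reversal_weight_bit) (auto simp: reduced_expr_def)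
    also have "\<dots> = 1"
      using that assms by (simp add: crossing_bit_distinct)
    finally show ?thesis
      using crossing_bit_mem[of H \<one> xs] by simp
  qed
  then have "card (set (refls G \<one> ys)) \<le> card (set (refls G \<one> xs))"
    by (intro card_mono) auto
  then have "length ys \<le> length xs"
    using distinct_card[OF assms(2)] card_length[of "refls G \<one> xs"] by simp
  then show ?thesis
    using xs assms len_aff_le[of ys] by (auto simp: reduced_expr_def)
qed

lemma reduced_iff_distinct:
  "xs \<in> lists S \<Longrightarrow> reduced_expr G S xs (wprod G xs) \<longleftrightarrow> distinct (refls G \<one> xs)"
  using distinct_reduced reduced_distinct by blast

lemma reduced_append:
  assumes "xs \<in> lists S" "ys \<in> lists S" "reduced_expr G S (xs @ ys) (wprod G (xs @ ys))"
  shows "reduced_expr G S xs (wprod G xs)" "reduced_expr G S ys (wprod G ys)"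
proof -
  have "distinct (refls G \<one> xs @ refls G (wprod G xs) ys)"
    using assms reduced_distinct[OF assms(3)] by (simp add: refls_append)
  then show "reduced_expr G S xs (wprod G xs)" "reduced_expr G S ys (wprod G ys)"
    using assms distinct_refls_base[of "wprod G xs" ys] by (auto simp: reduced_iff_distinct)
qed

lemma sep1_subset_refls:
  assumes "xs \<in> lists S"
  shows "sep1 G S (wprod G xs) \<subseteq> set (refls G \<one> xs)"
  using exists_reduced[OF wprod_lists_Wa[OF assms]] sep1_eq reduced_refls_subset assms by metis

text \<open>A reversal weight takes the same value at all panels of the wall H seen from one side of H:
  a reduced gallery between two such chambers and its mirror image do not cross H.\<close>

lemma weight_same_side:
  assumes f: "reversal_weight f"
    and v: "v \<in> Wa" "v' \<in> Wa" and s: "s \<in> S" "s' \<in> S"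
    and H: "v \<otimes> s \<otimes> inv v = H" "v' \<otimes> s' \<otimes> inv v' = H"
    and sep: "H \<notin> sep1 G S v" "H \<notin> sep1 G S v'"
  shows "f v s = f v' s'"
proof -
  define z where "z = inv v \<otimes> v'"
  have vc: "v \<in> carrier G" "v' \<in> carrier G" "H \<in> carrier G"
    using v Wa_carrier H s by auto
  have "z \<in> Wa"
    using v Wa_subgroup by (auto simp: z_def intro: subgroup.m_closed subgroup.m_inv_closed)
  then obtain zs where zs: "reduced_expr G S zs z"
    using exists_reduced by blast
  obtain xs where xs: "reduced_expr G S xs v"
    using exists_reduced v by blast
  obtain ys where ys: "reduced_expr G S ys v'"
    using exists_reduced v by blast
  have L: "zs \<in> lists S" "xs \<in> lists S" "ys \<in> lists S" and
    W: "wprod G zs = z" "wprod G xs = v" "wprod G ys = v'"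
    using xs ys zs by (auto simp: reduced_expr_def)
  have vz: "v \<otimes> z = v'"
    using vc by (simp add: z_def m_assoc[symmetric])
  \<comment> \<open>Neither v nor v' is separated from the unit chamber by H, so by parity the
    stretch \<open>zs\<close> from v to v' meets H an even number of times; being reduced, it does
    not meet H.\<close>
  have "crossing G (\<lambda>_ _. 1 :: bit) H \<one> (xs @ zs) = crossing G (\<lambda>_ _. 1 :: bit) H \<one> ys"
    using L W vc vz by (intro crossing_cong reversal_weight_bit) (auto simp: wprod_append)
  moreover have "crossing G (\<lambda>_ _. 1 :: bit) H \<one> ys = 0" "crossing G (\<lambda>_ _. 1 :: bit) H \<one> xs = 0"
    using sep sep1_eq[OF xs] sep1_eq[OF ys] by (auto intro!: crossing_eq_0)
  ultimately have "crossing G (\<lambda>_ _. 1 :: bit) H v zs = 0"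
    using L W vc by (simp add: crossing_append)
  moreover have "distinct (refls G v zs)"
    using distinct_refls_base[of v zs] reduced_distinct[OF zs] L vc by simp
  ultimately have notin: "H \<notin> set (refls G v zs)"
    by (auto simp: crossing_bit_distinct)
  \<comment> \<open>The chamber across the panel is the mirror image H v, so \<open>zs\<close> read
    from there is the mirror image of the gallery from v to v'.\<close>
  have Hv: "v \<otimes> s = H \<otimes> v"
    using H(1) vc s by (simp add: inv_solve_right'[symmetric] m_assoc) 
  have notin': "H \<notin> set (refls G (v \<otimes> s) zs)"
  proof
    assume "H \<in> set (refls G (v \<otimes> s) zs)"
    then obtain K where K: "K \<in> set (refls G v zs)" "H = H \<otimes> K \<otimes> inv H"
      using refls_conj[of H v zs] vc L by (auto simp: Hv)
    have "K \<in> carrier G"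
      using K refls_closed[of v zs] vc L by auto
    then have "H \<otimes> K \<otimes> inv H = H \<otimes> H \<otimes> inv H \<longleftrightarrow> K = H"
      using vc by simp
    then have "K = H"
      using K vc by (simp add: m_assoc)
    with K notin show False
      by simp
  qed
  have "v \<otimes> s \<otimes> z = v \<otimes> (z \<otimes> s')"
  proof -
    have "v \<otimes> s \<otimes> z = H \<otimes> v'"
      using Hv vz vc \<open>z \<in> Wa\<close> Wa_carrier by (simp add: m_assoc)
    also have "\<dots> = v' \<otimes> s'"
      using H(2)[symmetric] vc s by (simp add: m_assoc)
    also have "\<dots> = v \<otimes> (z \<otimes> s')"
      using vz vc \<open>z \<in> Wa\<close> Wa_carrier s by (simp add: m_assoc[symmetric])
    finally show ?thesis .
  qed
  then have "wprod G (s # zs) = wprod G (zs @ [s'])"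
    using L W vc s \<open>z \<in> Wa\<close> Wa_carrier by (simp add: wprod_append m_assoc)
  \<comment> \<open>Both words lead from v to the same chamber. The first passes H only in its first
    step, with weight \<open>f v s\<close>; the second only in its last step, with weight
    \<open>f v' s'\<close>.\<close>
  then have "crossing G f H v (s # zs) = crossing G f H v (zs @ [s'])"
    using L s vc by (intro crossing_cong f) auto
  then show ?thesis
    using notin notin' H vc L W vz s by (simp add: crossing_append crossing_eq_0)
qed

end

section \<open>Inverses of units in a commutative ring\<close>

lemma rinv_unique:
  fixes x :: "'a::comm_ring_1"
  assumes "x * y = 1"
  shows "rinv x = y"
proof -
  have "z = y" if "x * z = 1" for z
  proof -
    have "z = (x * y) * z"
      using assms by simp
    also have "\<dots> = (x * z) * y"
      by (simp only: mult_ac)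
    finally show ?thesis
      using that by simp
  qed
  then show ?thesis
    unfolding rinv_def using assms by (intro the_equality)
qed

lemma rinv_right: "x dvd 1 \<Longrightarrow> x * rinv x = (1::'a::comm_ring_1)"
  using rinv_unique by (metis dvdE)

lemma rinv_one [simp]: "rinv (1::'a::comm_ring_1) = 1"
  by (simp add: rinv_unique)

lemma rinv_mult:
  fixes x y :: "'a::comm_ring_1"
  assumes "x dvd 1" "y dvd 1"
  shows "rinv (x * y) = rinv x * rinv y"
proof (rule rinv_unique)
  have "x * y * (rinv x * rinv y) = (x * rinv x) * (y * rinv y)"
    by (simp only: mult_ac)
  then show "x * y * (rinv x * rinv y) = 1"
    using assms by (simp add: rinv_right)
qed

lemma (in group) inv_mult_cancel [simp]:
  "x \<in> carrier G \<Longrightarrow> y \<in> carrier G \<Longrightarrow> inv x \<otimes> (x \<otimes> y) = y"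
  "x \<in> carrier G \<Longrightarrow> y \<in> carrier G \<Longrightarrow> x \<otimes> (inv x \<otimes> y) = y"
  by (simp_all add: m_assoc[symmetric])

section \<open>The pro-p Coxeter group and its decomposition into words and elements of length
  zero\<close>

locale hecke =
  fixes D :: "('w, 'v, 'r::comm_ring_1, 'h::ring_1) phdata"
  assumes hecke: "generic_hecke D" and sqrts: "sqrt_choice D"
begin

abbreviation G where "G \<equiv> Wg D"
abbreviation V where "V \<equiv> W1g D"
abbreviation S where "S \<equiv> Sg D"
abbreviation \<pi> where "\<pi> \<equiv> prj D"
abbreviation wmult (infixl "\<cdot>" 70) where "x \<cdot> y \<equiv> x \<otimes>\<^bsub>Wg D\<^esub> y"
abbreviation winv where "winv x \<equiv> inv\<^bsub>Wg D\<^esub> x"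
abbreviation vmult (infixl "\<star>" 70) where "x \<star> y \<equiv> x \<otimes>\<^bsub>W1g D\<^esub> y"
abbreviation vinv where "vinv x \<equiv> inv\<^bsub>W1g D\<^esub> x"
abbreviation n where "n \<equiv> nl D"

lemma pro_p: "pro_p_coxeter D"
  and ext: "ext_coxeter D"
  using hecke unfolding generic_hecke_def pro_p_coxeter_def by blast+

sublocale W: coxeter "Wg D" "Waf D" "Sg D"
  using ext unfolding ext_coxeter_def coxeter_def coxeter_axioms_def by blast

sublocale V: group "W1g D"
  using pro_p unfolding pro_p_coxeter_def by blast

sublocale pi: group_hom "W1g D" "Wg D" "prj D"
  using pro_p unfolding pro_p_coxeter_def group_hom_def group_hom_axioms_def
  using V.is_group W.is_group by blast

lemma pi_surj: "x \<in> carrier G \<Longrightarrow> \<exists>w\<in>carrier V. \<pi> w = x"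
proof -
  assume "x \<in> carrier G"
  also have "carrier G = \<pi> ` carrier V"
    using pro_p unfolding pro_p_coxeter_def by blast
  finally show ?thesis
    by blast
qed

lemma n_carrier [simp]: "s \<in> S \<Longrightarrow> n s \<in> carrier V"
  and pi_n [simp]: "s \<in> S \<Longrightarrow> \<pi> (n s) = s"
  using pro_p unfolding pro_p_coxeter_def by blast+

lemma Waf_subgroup: "subgroup (Waf D) G"
  and Omg_subgroup: "subgroup (Omg D) G"
  and Waf_Omg: "Waf D \<inter> Omg D = {\<one>\<^bsub>G\<^esub>}"
  and Waf_Omg_ex: "x \<in> carrier G \<Longrightarrow> \<exists>v\<in>Waf D. \<exists>u\<in>Omg D. x = v \<cdot> u"
  and Omg_S: "u \<in> Omg D \<Longrightarrow> s \<in> S \<Longrightarrow> u \<cdot> s \<cdot> winv u \<in> S"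
  using ext W.Wa_subgroup unfolding ext_coxeter_def by blast+

lemma Waf_carrier [simp]: "v \<in> Waf D \<Longrightarrow> v \<in> carrier G"
  and Omg_carrier [simp]: "u \<in> Omg D \<Longrightarrow> u \<in> carrier G"
  using Waf_subgroup Omg_subgroup subgroup.mem_carrier by metis+

lemma Waf_mult [simp]: "v \<in> Waf D \<Longrightarrow> v' \<in> Waf D \<Longrightarrow> v \<cdot> v' \<in> Waf D"
  and Waf_one [simp]: "\<one>\<^bsub>G\<^esub> \<in> Waf D"
  and S_Waf [simp]: "s \<in> S \<Longrightarrow> s \<in> Waf D"
  and Omg_mult [simp]: "u \<in> Omg D \<Longrightarrow> u' \<in> Omg D \<Longrightarrow> u \<cdot> u' \<in> Omg D"
  and Omg_one [simp]: "\<one>\<^bsub>G\<^esub> \<in> Omg D"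
  and Omg_inv [simp]: "u \<in> Omg D \<Longrightarrow> winv u \<in> Omg D"
  using Waf_subgroup Omg_subgroup W.S_Wa
  by (auto intro: subgroup.m_closed subgroup.one_closed subgroup.m_inv_closed)

lemma decomp_unique:
  assumes "v \<in> Waf D" "v' \<in> Waf D" "u \<in> Omg D" "u' \<in> Omg D" "v \<cdot> u = v' \<cdot> u'"
  shows "v = v'" "u = u'"
proof -
  have "winv v' \<cdot> v = winv v' \<cdot> (v \<cdot> u) \<cdot> winv u"
    using assms(1-4) by (simp add: W.m_assoc)
  also have "\<dots> = winv v' \<cdot> (v' \<cdot> u') \<cdot> winv u"
    by (simp only: assms(5))
  also have "\<dots> = u' \<cdot> winv u"
    using assms(1-4) by (simp add: W.m_assoc[symmetric])
  finally have eq: "winv v' \<cdot> v = u' \<cdot> winv u" .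
  moreover have "winv v' \<cdot> v \<in> Waf D" "u' \<cdot> winv u \<in> Omg D"
    using assms Waf_subgroup by (auto intro: subgroup.m_closed subgroup.m_inv_closed)
  ultimately have "winv v' \<cdot> v = \<one>\<^bsub>G\<^esub>" "u' \<cdot> winv u = \<one>\<^bsub>G\<^esub>"
    using Waf_Omg by auto
  then show "v = v'" "u = u'"
    using assms by (metis Waf_carrier W.inv_equality W.inv_inv W.inv_closed)
      (use \<open>u' \<cdot> winv u = _\<close> assms in \<open>metis Omg_carrier W.inv_equality W.inv_inv W.inv_closed\<close>)
qed

lemma aff_part_eq [simp]: "v \<in> Waf D \<Longrightarrow> u \<in> Omg D \<Longrightarrow> aff_part D (v \<cdot> u) = v"
  unfolding aff_part_def by (intro the_equality) (auto dest: decomp_unique)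

lemma om_part_eq [simp]: "v \<in> Waf D \<Longrightarrow> u \<in> Omg D \<Longrightarrow> om_part D (v \<cdot> u) = u"
  unfolding om_part_def by (intro the_equality) (auto dest: decomp_unique)

lemma aff_part_Waf [simp]: "v \<in> Waf D \<Longrightarrow> aff_part D v = v"
  using aff_part_eq[of v "\<one>\<^bsub>G\<^esub>"] by simp

lemma aff_part_Omg [simp]: "u \<in> Omg D \<Longrightarrow> aff_part D u = \<one>\<^bsub>G\<^esub>"
  using aff_part_eq[of "\<one>\<^bsub>G\<^esub>" u] by simp

lemma aff_part_mult_Omg: "x \<in> carrier G \<Longrightarrow> u \<in> Omg D \<Longrightarrow> aff_part D (x \<cdot> u) = aff_part D x"
  using Waf_Omg_ex[of x] by (auto simp: W.m_assoc)

lemma len_one [simp]: "len_aff G S \<one>\<^bsub>G\<^esub> = 0"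
  using W.len_aff_le[of "[]"] by simp

lemma reduced_Nil: "reduced_expr G S [] \<one>\<^bsub>G\<^esub>"
  by (simp add: reduced_expr_def)

lemma reduced_single: "s \<in> S \<Longrightarrow> reduced_expr G S [s] s"
  using W.distinct_reduced[of "[s]"] by simp

lemma len_S: "s \<in> S \<Longrightarrow> len_aff G S s = 1"
  using reduced_single[of s] by (simp add: reduced_expr_def)

lemma Tgrp_iff: "t \<in> Tgrp D \<longleftrightarrow> t \<in> carrier V \<and> \<pi> t = \<one>\<^bsub>G\<^esub>"
  by (auto simp: Tgrp_def kernel_def)

lemma TgrpI: "t \<in> carrier V \<Longrightarrow> \<pi> t = \<one>\<^bsub>G\<^esub> \<Longrightarrow> t \<in> Tgrp D"
  and Tgrp_carrier [simp]: "t \<in> Tgrp D \<Longrightarrow> t \<in> carrier V"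
  and Tgrp_pi [simp]: "t \<in> Tgrp D \<Longrightarrow> \<pi> t = \<one>\<^bsub>G\<^esub>"
  unfolding Tgrp_iff by blast+

lemma Om1I: "u \<in> carrier V \<Longrightarrow> \<pi> u \<in> Omg D \<Longrightarrow> u \<in> Om1 D"
  and Om1_carrier [simp]: "u \<in> Om1 D \<Longrightarrow> u \<in> carrier V"
  and Om1_pi [simp]: "u \<in> Om1 D \<Longrightarrow> \<pi> u \<in> Omg D"
  unfolding Om1_def by blast+

lemma Tgrp_Om1: "t \<in> Tgrp D \<Longrightarrow> t \<in> Om1 D"
  by (rule Om1I) simp_all

lemma Om1_mult [simp]: "u \<in> Om1 D \<Longrightarrow> u' \<in> Om1 D \<Longrightarrow> u \<star> u' \<in> Om1 D"
  by (rule Om1I) simp_all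

lemma Tgrp_mult [simp]: "t \<in> Tgrp D \<Longrightarrow> t' \<in> Tgrp D \<Longrightarrow> t \<star> t' \<in> Tgrp D"
  by (rule TgrpI) simp_all

lemma Tgrp_inv [simp]: "t \<in> Tgrp D \<Longrightarrow> vinv t \<in> Tgrp D"
  by (rule TgrpI) simp_all

lemma Tgrp_one [simp]: "\<one>\<^bsub>V\<^esub> \<in> Tgrp D"
  by (rule TgrpI) simp_all

lemma Tgrp_comm: "t \<in> Tgrp D \<Longrightarrow> t' \<in> Tgrp D \<Longrightarrow> t \<star> t' = t' \<star> t"
  using pro_p unfolding pro_p_coxeter_def by blast

lemma Tgrp_conj [simp]: "t \<in> Tgrp D \<Longrightarrow> w \<in> carrier V \<Longrightarrow> w \<star> t \<star> vinv w \<in> Tgrp D"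
  by (rule TgrpI) simp_all

lemma Tgrp_conj' [simp]: "t \<in> Tgrp D \<Longrightarrow> w \<in> carrier V \<Longrightarrow> vinv w \<star> t \<star> w \<in> Tgrp D"
  by (rule TgrpI) simp_all

lemma lift_carrier: "x \<in> carrier G \<Longrightarrow> lift D x \<in> carrier V"
  and pi_lift: "x \<in> carrier G \<Longrightarrow> \<pi> (lift D x) = x"
  unfolding lift_def using someI_ex[of "\<lambda>y. y \<in> carrier V \<and> \<pi> y = x"] pi_surj by auto

definition N where "N xs = wprod V (map n xs)"

lemma N_Nil [simp]: "N [] = \<one>\<^bsub>V\<^esub>"
  and N_Cons [simp]: "N (s # xs) = n s \<star> N xs"
  by (simp_all add: N_def)

lemma map_n_carrier [simp]: "xs \<in> lists S \<Longrightarrow> set (map n xs) \<subseteq> carrier V"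
  by auto

lemma N_carrier [simp]: "xs \<in> lists S \<Longrightarrow> N xs \<in> carrier V"
  unfolding N_def by (rule V.wprod_closed) (rule map_n_carrier)

lemma N_append: "xs \<in> lists S \<Longrightarrow> ys \<in> lists S \<Longrightarrow> N (xs @ ys) = N xs \<star> N ys"
  unfolding N_def map_append by (intro V.wprod_append map_n_carrier)

lemma pi_N [simp]: "xs \<in> lists S \<Longrightarrow> \<pi> (N xs) = wprod G xs"
  by (induction xs) auto

lemma N_braid: "\<lbrakk>s \<in> S; t \<in> S; s \<noteq> t; cox_m G s t > 0\<rbrakk> \<Longrightarrow>
    N (alt_word s t (cox_m G s t)) = N (alt_word t s (cox_m G s t))"
  using pro_p unfolding pro_p_coxeter_def N_def by blast

lemma Om1_decomp:
  assumes "w \<in> carrier V"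
  obtains xs u where "reduced_expr G S xs (aff_part D (\<pi> w))" "u \<in> Om1 D" "w = N xs \<star> u"
proof -
  obtain v u where vu: "v \<in> Waf D" "u \<in> Omg D" "\<pi> w = v \<cdot> u"
    using Waf_Omg_ex[OF pi.hom_closed[OF assms]] by blast
  obtain xs where xs: "reduced_expr G S xs v"
    using W.exists_reduced vu by blast
  then have L: "xs \<in> lists S" "wprod G xs = v"
    by (auto simp: reduced_expr_def)
  have "vinv (N xs) \<star> w \<in> Om1 D"
    using assms L vu by (intro Om1I) (simp_all add: W.m_assoc[symmetric])
  moreover have "w = N xs \<star> (vinv (N xs) \<star> w)"
    using assms L by (simp add: V.m_assoc[symmetric])
  moreover have "aff_part D (\<pi> w) = v"
    using vu by simp
  ultimately show ?thesis
    using that xs by blast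
qed

subsection \<open>Orientations as weights on the chambers of W\<close>

text \<open>An orientation read on all chambers of W, not only on the affine part, so that galleries
  may start at any element of W. The last clause records how Omega moves the labels of the
  panels.\<close>

definition oriented :: "('w \<Rightarrow> 'w \<Rightarrow> int) \<Rightarrow> bool" where
  "oriented f \<longleftrightarrow>
     (\<forall>v\<in>carrier G. \<forall>s\<in>S. f v s = 1 \<or> f v s = -1) \<and>
     (\<forall>v\<in>carrier G. \<forall>s\<in>S. f (v \<cdot> s) s = - f v s) \<and>
     (\<forall>v\<in>carrier G. \<forall>s\<in>S. \<forall>t\<in>S. cox_m G s t > 0 \<longrightarrow>
        (let m = cox_m G s t; q = signs G f v (alt_word s t m); q' = signs G f v (alt_word t s m)
         in \<exists>k\<le>m. (q = replicate k 1 @ replicate (m - k) (-1) \<and>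
                    q' = replicate (m - k) (-1) @ replicate k 1) \<or>
                   (q = replicate (m - k) (-1) @ replicate k 1 \<and>
                    q' = replicate k 1 @ replicate (m - k) (-1)))) \<and>
     (\<forall>v\<in>carrier G. \<forall>u\<in>Omg D. \<forall>s\<in>S. f (v \<cdot> u) s = f v (u \<cdot> s \<cdot> winv u))"

lemma oriented_sign: "oriented f \<Longrightarrow> v \<in> carrier G \<Longrightarrow> s \<in> S \<Longrightarrow> f v s = 1 \<or> f v s = -1"
  and oriented_flip: "oriented f \<Longrightarrow> v \<in> carrier G \<Longrightarrow> s \<in> S \<Longrightarrow> f (v \<cdot> s) s = - f v s"
  and oriented_Omg: "oriented f \<Longrightarrow> v \<in> carrier G \<Longrightarrow> u \<in> Omg D \<Longrightarrow> s \<in> S \<Longrightarrow>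
      f (v \<cdot> u) s = f v (u \<cdot> s \<cdot> winv u)"
  unfolding oriented_def by blast+

lemma oriented_braid:
  assumes "oriented f" "v \<in> carrier G" "s \<in> S" "t \<in> S" "cox_m G s t > 0" and m: "m = cox_m G s t"
  obtains k where "k \<le> m" "signs G f v (alt_word s t m) = replicate k 1 @ replicate (m - k) (-1)"
      "signs G f v (alt_word t s m) = replicate (m - k) (-1) @ replicate k 1"
  | k where "k \<le> m" "signs G f v (alt_word s t m) = replicate (m - k) (-1) @ replicate k 1"
      "signs G f v (alt_word t s m) = replicate k 1 @ replicate (m - k) (-1)"
  using assms unfolding oriented_def Let_def by blast

text \<open>The two sign sequences allowed by (OR2) for a braid pair are reversals of each
  other.\<close>

lemma oriented_weight: "oriented f \<Longrightarrow> W.reversal_weight f"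
  unfolding W.reversal_weight_def
proof (intro conjI ballI impI, goal_cases)
  case (2 v s t)
  show ?case
    by (rule oriented_braid[OF 2 refl]) auto
qed (auto simp: oriented_flip)

definition on_W :: "('v \<Rightarrow> 'w \<Rightarrow> int) \<Rightarrow> 'w \<Rightarrow> 'w \<Rightarrow> int" where
  "on_W ori v s = ori (lift D v) s"

lemma cox_m_conj:
  assumes "u \<in> carrier G" "s \<in> carrier G" "t \<in> carrier G"
  shows "cox_m G (u \<cdot> s \<cdot> winv u) (u \<cdot> t \<cdot> winv u) = cox_m G s t"
proof -
  have "u \<cdot> s \<cdot> winv u \<cdot> (u \<cdot> t \<cdot> winv u) = u \<cdot> s \<cdot> (winv u \<cdot> u) \<cdot> t \<cdot> winv u"
    using assms by (simp add: W.m_assoc del: W.l_inv)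
  then have st: "u \<cdot> s \<cdot> winv u \<cdot> (u \<cdot> t \<cdot> winv u) = u \<cdot> (s \<cdot> t) \<cdot> winv u"
    using assms by (simp add: W.m_assoc)
  have pow: "(u \<cdot> x \<cdot> winv u) [^]\<^bsub>G\<^esub> k = u \<cdot> (x [^]\<^bsub>G\<^esub> k) \<cdot> winv u" if "x \<in> carrier G" for x and k :: nat
  proof (induction k)
    case (Suc k)
    have "u \<cdot> x [^]\<^bsub>G\<^esub> k \<cdot> winv u \<cdot> (u \<cdot> x \<cdot> winv u) = u \<cdot> x [^]\<^bsub>G\<^esub> k \<cdot> (winv u \<cdot> u) \<cdot> x \<cdot> winv u"
      using assms that by (simp add: W.m_assoc del: W.l_inv)
    then show ?case
      using assms that Suc by (simp add: W.m_assoc)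
  qed (use assms in simp)
  have "u \<cdot> x \<cdot> winv u = \<one>\<^bsub>G\<^esub> \<longleftrightarrow> x = \<one>\<^bsub>G\<^esub>" if "x \<in> carrier G" for x
    using W.conj_eq_iff[of u x "\<one>\<^bsub>G\<^esub>"] assms that by simp
  then have "((u \<cdot> s \<cdot> winv u \<cdot> (u \<cdot> t \<cdot> winv u)) [^]\<^bsub>G\<^esub> k = \<one>\<^bsub>G\<^esub>) = ((s \<cdot> t) [^]\<^bsub>G\<^esub> k = \<one>\<^bsub>G\<^esub>)" for k :: nat
    using pow[of "s \<cdot> t" k] assms by (simp add: st)
  then show ?thesis
    by (simp only: cox_m_def)
qed

lemma orientation_on_W:
  assumes "orientation D ori"
  shows "oriented (on_W ori)"
    and "w \<in> carrier V \<Longrightarrow> s \<in> S \<Longrightarrow> ori w s = on_W ori (\<pi> w) s"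
proof -
  obtain f0 where sg: "OR_signs D f0" and or1: "OR1 D f0" and or2: "OR2 D f0"
    and ori: "\<And>w s. w \<in> carrier V \<Longrightarrow> s \<in> S \<Longrightarrow>
       ori w s = f0 (aff_part D (\<pi> w)) (om_part D (\<pi> w) \<cdot> s \<cdot> winv (om_part D (\<pi> w)))"
    using assms unfolding orientation_def by blast
  let ?f = "on_W ori"
  have f: "?f (v \<cdot> u) s = f0 v (u \<cdot> s \<cdot> winv u)" if "v \<in> Waf D" "u \<in> Omg D" "s \<in> S" for v u s
    using that by (simp add: on_W_def ori lift_carrier pi_lift)
  show "ori w s = on_W ori (\<pi> w) s" if "w \<in> carrier V" "s \<in> S" for w s
    using that by (simp add: on_W_def ori lift_carrier pi_lift)
  \<comment> \<open>Moving u to the right past a letter conjugates the letter, so a gallery from v u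
    has the signs of the gallery from v along the conjugated word. Since conjugation preserves
    m(s,t), (OR2) carries over from W_aff to W.\<close>
  have step: "v \<cdot> u \<cdot> s = v \<cdot> (u \<cdot> s \<cdot> winv u) \<cdot> u" if "v \<in> Waf D" "u \<in> Omg D" "s \<in> S" for v u s
    using that by (simp add: W.m_assoc)
  have sgn: "signs G ?f (v \<cdot> u) xs = signs G f0 v (map (\<lambda>s. u \<cdot> s \<cdot> winv u) xs)"
    if "v \<in> Waf D" "u \<in> Omg D" "xs \<in> lists S" for v u xs
    using that by (induction xs arbitrary: v) (simp_all add: f step Omg_S)
  have gal: "gallery_signs D f0 v s t m = signs G f0 v (alt_word s t m)"
    if "v \<in> Waf D" "s \<in> S" "t \<in> S" for v s t m
    using that W.lists_carrier[OF alt_word_lists[of s S t m]]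
    by (intro nth_equalityI) (simp_all add: gallery_signs_def W.signs_nth)
  have 1: "?f x s = 1 \<or> ?f x s = -1" if "x \<in> carrier G" "s \<in> S" for x s
  proof -
    obtain v u where vu: "v \<in> Waf D" "u \<in> Omg D" "x = v \<cdot> u"
      using Waf_Omg_ex[OF \<open>x \<in> carrier G\<close>] by blast
    then show ?thesis
      using sg that by (simp add: f OR_signs_def Omg_S)
  qed
  have 2: "?f (x \<cdot> s) s = - ?f x s" if "x \<in> carrier G" "s \<in> S" for x s
  proof -
    obtain v u where vu: "v \<in> Waf D" "u \<in> Omg D" "x = v \<cdot> u"
      using Waf_Omg_ex[OF \<open>x \<in> carrier G\<close>] by blast
    then show ?thesis
      using or1 that by (simp add: f step Omg_S OR1_def)
  qed
  have 4: "?f (x \<cdot> u) s = ?f x (u \<cdot> s \<cdot> winv u)" if "x \<in> carrier G" "u \<in> Omg D" "s \<in> S" for x u s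
  proof -
    obtain v u' where vu: "v \<in> Waf D" "u' \<in> Omg D" "x = v \<cdot> u'"
      using Waf_Omg_ex[OF \<open>x \<in> carrier G\<close>] by blast
    have "x \<cdot> u = v \<cdot> (u' \<cdot> u)"
      using vu that by (simp add: W.m_assoc)
    then have "?f (x \<cdot> u) s = f0 v (u' \<cdot> u \<cdot> s \<cdot> winv (u' \<cdot> u))"
      using vu that by (simp add: f)
    then show ?thesis
      using vu that Omg_S[of u s] by (simp add: f W.inv_mult_group W.m_assoc)
  qed
  have 3: "\<exists>k\<le>m. (q = replicate k 1 @ replicate (m - k) (-1) \<and>
                    q' = replicate (m - k) (-1) @ replicate k 1) \<or>
                   (q = replicate (m - k) (-1) @ replicate k 1 \<and>
                    q' = replicate k 1 @ replicate (m - k) (-1))"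
    if x: "x \<in> carrier G" "s \<in> S" "t \<in> S" "cox_m G s t > 0" and m: "m = cox_m G s t"
      and q: "q = signs G ?f x (alt_word s t m)" "q' = signs G ?f x (alt_word t s m)"
    for x s t m q q'
  proof -
    obtain v u where vu: "v \<in> Waf D" "u \<in> Omg D" "x = v \<cdot> u"
      using Waf_Omg_ex[OF x(1)] by blast
    let ?s = "u \<cdot> s \<cdot> winv u" and ?t = "u \<cdot> t \<cdot> winv u"
    have "cox_m G ?s ?t = m"
      using vu x m by (simp add: cox_m_conj)
    moreover have "q = gallery_signs D f0 v ?s ?t m" "q' = gallery_signs D f0 v ?t ?s m"
      using vu x q by (simp_all add: sgn gal alt_word_lists map_alt_word Omg_S)
    moreover have "?s \<in> S" "?t \<in> S"
      using vu x Omg_S by auto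
    ultimately show ?thesis
      using or2 vu(1) x(4) m unfolding OR2_def Let_def by (metis (no_types, lifting))
  qed
  show "oriented ?f"
    unfolding oriented_def Let_def using 1 2 3 4 by simp
qed

text \<open>The definition chooses a panel of H on the side of the unit chamber; an orientation is a
  reversal weight, so all such panels carry the same sign.\<close>

lemma o1H_eq:
  assumes "orientation D ori" "v \<in> Waf D" "s \<in> S" "v \<cdot> s \<cdot> winv v = H" "H \<notin> sep1 G S v"
  shows "o1H D ori H = on_W ori v s"
proof -
  define p where "p = (SOME p. fst p \<in> Waf D \<and> snd p \<in> S \<and> fst p \<cdot> snd p \<cdot> winv (fst p) = H \<and>
      H \<notin> sep1 G S (fst p))"
  have "fst p \<in> Waf D \<and> snd p \<in> S \<and> fst p \<cdot> snd p \<cdot> winv (fst p) = H \<and> H \<notin> sep1 G S (fst p)"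
    unfolding p_def by (rule someI[of _ "(v, s)"]) (use assms in simp)
  then have "on_W ori (fst p) (snd p) = on_W ori v s"
    using assms orientation_on_W(1)[THEN oriented_weight]
    by (intro W.weight_same_side[where H = H]) auto
  then show ?thesis
    by (simp add: o1H_def p_def[symmetric] on_W_def)
qed

section \<open>The basis of the Hecke algebra and its normalization\<close>

lemma io_one [simp]: "io D 1 = 1"
  and io_mult: "io D (x * y) = io D x * io D y"
  and io_central: "io D x * h = h * io D x"
  and Tb_span: "\<exists>c. finite {w. c w \<noteq> 0} \<and> {w. c w \<noteq> 0} \<subseteq> carrier V \<and>
              h = (\<Sum>w\<in>{w. c w \<noteq> 0}. io D (c w) * Tb D w)"
  and Tb_mult: "\<lbrakk>w \<in> carrier V; w' \<in> carrier V; len1 D (w \<star> w') = len1 D w + len1 D w'\<rbrakk> \<Longrightarrow>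
        Tb D (w \<star> w') = Tb D w * Tb D w'"
  and Tb_quad: "s \<in> S \<Longrightarrow> Tb D (n s) * Tb D (n s) =
        io D (ap D s) * Tb D (n s \<star> n s) + Tb D (n s) * emb D (bp D s)"
  and bp_rt: "s \<in> S \<Longrightarrow> rt_elem D (bp D s)"
  and bp_eq: "\<lbrakk>s \<in> S; t \<in> S; w \<in> carrier V; s \<cdot> \<pi> w = \<pi> w \<cdot> t\<rbrakk> \<Longrightarrow>
        transl D (n s \<star> w \<star> vinv (n t) \<star> vinv w) (conj_act D w (bp D t)) = bp D s"
  using hecke unfolding generic_hecke_def hecke_params_def by blast+

lemma io_left_commute: "h * (io D x * k) = io D x * (h * k)"
  by (metis io_central mult.assoc)

lemma len1_Om1 [simp]: "u \<in> Om1 D \<Longrightarrow> len1 D u = 0"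
  by (simp add: len1_def lenW_def)

lemma len1_one [simp]: "len1 D \<one>\<^bsub>V\<^esub> = 0"
  by (simp add: len1_def lenW_def)

text \<open>Lengths add in 1 w, so T_1 fixes every basis element and hence every element of the
  algebra; this identifies T_1 with the ring unit.\<close>

lemma Tb_one_left: "Tb D \<one>\<^bsub>V\<^esub> * h = h"
proof -
  obtain c where c: "finite {w. c w \<noteq> 0}" "{w. c w \<noteq> 0} \<subseteq> carrier V"
    "h = (\<Sum>w\<in>{w. c w \<noteq> 0}. io D (c w) * Tb D w)"
    using Tb_span[of h] by blast
  have "Tb D \<one>\<^bsub>V\<^esub> * (io D (c w) * Tb D w) = io D (c w) * Tb D w" if "w \<in> carrier V" for w
    using Tb_mult[of "\<one>\<^bsub>V\<^esub>" w] that by (simp add: io_left_commute)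
  then show ?thesis
    unfolding c(3) sum_distrib_left using c(2) by (intro sum.cong) auto
qed

lemma Tb_one [simp]: "Tb D \<one>\<^bsub>V\<^esub> = 1"
  using Tb_one_left[of 1] by simp

lemma Tb_Om1_right: "g \<in> carrier V \<Longrightarrow> u \<in> Om1 D \<Longrightarrow> Tb D (g \<star> u) = Tb D g * Tb D u"
  by (rule Tb_mult) (simp_all, simp add: len1_def lenW_def aff_part_mult_Omg)

lemma Tb_Om1_inv: "t \<in> Tgrp D \<Longrightarrow> Tb D t * Tb D (vinv t) = 1"
  using Tb_Om1_right[of t "vinv t"] by (simp add: Tgrp_Om1)

lemma aff_part_Omg_left: "u \<in> Omg D \<Longrightarrow> s \<in> S \<Longrightarrow> aff_part D (u \<cdot> s) = u \<cdot> s \<cdot> winv u"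
  using aff_part_eq[of "u \<cdot> s \<cdot> winv u" u] Omg_S[of u s] by (simp add: W.m_assoc)

lemma Tb_Om1_left:
  assumes "g \<in> carrier V" "\<pi> g \<in> S" "u \<in> Om1 D"
  shows "Tb D (u \<star> g) = Tb D u * Tb D g"
  using assms Omg_S[of "\<pi> u" "\<pi> g"]
  by (intro Tb_mult) (simp_all, simp add: len1_def lenW_def aff_part_Omg_left len_S)

lemma sq_unit: "s \<in> S \<Longrightarrow> sq D s dvd 1"
  using sqrts unfolding sqrt_choice_def by (metis dvd_def mult.assoc)

lemma sq_sq: "s \<in> S \<Longrightarrow> sq D s * sq D s = ap D s"
  using sqrts unfolding sqrt_choice_def by blast

lemma sq_conj: "\<lbrakk>s \<in> S; t \<in> S; x \<in> carrier G; t = winv x \<cdot> s \<cdot> x\<rbrakk> \<Longrightarrow> sq D s = sq D t"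
  using sqrts unfolding sqrt_choice_def by blast

lemma sq_commute:
  assumes "s \<in> S" "t \<in> S" "x \<in> carrier G" "s \<cdot> x = x \<cdot> t"
  shows "sq D s = sq D t"
  using assms by (intro sq_conj[of s t x]) (simp_all add: W.m_assoc)

text \<open>Two generators that are both conjugate to H are conjugate to each other, so the
  generator chosen in \<open>sqrtH\<close> does not affect the root.\<close>

lemma sqrtH_eq:
  assumes "s \<in> S" "x \<in> carrier G"
  shows "sqrtH D (x \<cdot> s \<cdot> winv x) = sq D s"
proof -
  let ?P = "\<lambda>s'. s' \<in> S \<and> (\<exists>y\<in>carrier G. x \<cdot> s \<cdot> winv x = y \<cdot> s' \<cdot> winv y)"
  define s' where "s' = (SOME s'. ?P s')"
  have "?P s'"
    unfolding s'_def by (rule someI[of ?P s]) (use assms in blast)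
  then obtain y where y: "s' \<in> S" "y \<in> carrier G" "x \<cdot> s \<cdot> winv x = y \<cdot> s' \<cdot> winv y"
    by blast
  have "s' \<cdot> (winv y \<cdot> x) = winv y \<cdot> (y \<cdot> s' \<cdot> winv y) \<cdot> x"
    using assms y by (simp add: W.m_assoc)
  also have "\<dots> = (winv y \<cdot> x) \<cdot> s"
    using assms y(1,2) by (simp add: y(3)[symmetric] W.m_assoc)
  finally have "sq D s' = sq D s"
    using assms y by (intro sq_commute[of s' s "winv y \<cdot> x"]) simp_all
  then show ?thesis
    by (simp add: sqrtH_def s'_def)
qed

lemma sqrtH_refls: "v \<in> carrier G \<Longrightarrow> xs \<in> lists S \<Longrightarrow> map (sqrtH D) (refls G v xs) = map (sq D) xs"
  by (induction xs arbitrary: v) (simp_all add: sqrtH_eq)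

text \<open>A reduced word meets each separating hyperplane once, so the product over the set
  becomes a product over the letters.\<close>

lemma Lbar_eq:
  assumes "reduced_expr G S xs (aff_part D (\<pi> w))"
  shows "Lbar D w = prod_list (map (sq D) xs)"
proof -
  have "xs \<in> lists S"
    using assms by (simp add: reduced_expr_def)
  then show ?thesis
    using prod.distinct_set_conv_list[OF W.reduced_distinct[OF assms], of "sqrtH D"]
    by (simp add: Lbar_def W.sep1_eq[OF assms] sqrtH_refls)
qed

lemma prod_sq_unit: "xs \<in> lists S \<Longrightarrow> prod_list (map (sq D) xs) dvd 1"
proof (induction xs)
  case (Cons s xs)
  then show ?case
    using mult_dvd_mono[of "sq D s" 1 "prod_list (map (sq D) xs)" 1] by (simp add: sq_unit)
qed simp

definition Tn :: "'v \<Rightarrow> 'h" where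
  "Tn w = io D (rinv (Lbar D w)) * Tb D w"

text \<open>When reduced words concatenate to a reduced word, lengths add and the normalizing
  scalars multiply as well.\<close>

lemma Tn_mult:
  assumes "g \<in> carrier V" "h \<in> carrier V" "xs \<in> lists S" "ys \<in> lists S"
    and "\<pi> g = wprod G xs" "\<pi> h = wprod G ys" "reduced_expr G S (xs @ ys) (wprod G (xs @ ys))"
  shows "Tn (g \<star> h) = Tn g * Tn h"
proof -
  have red: "reduced_expr G S xs (aff_part D (\<pi> g))" "reduced_expr G S ys (aff_part D (\<pi> h))"
    using W.reduced_append[of xs ys] assms W.wprod_lists_Wa by simp_all
  have redm: "reduced_expr G S (xs @ ys) (aff_part D (\<pi> (g \<star> h)))"
    using assms W.wprod_lists_Wa by (simp add: W.wprod_append)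
  then have "len1 D (g \<star> h) = len1 D g + len1 D h"
    using red by (simp add: reduced_expr_def len1_def lenW_def)
  then have "Tb D (g \<star> h) = Tb D g * Tb D h"
    using assms by (intro Tb_mult)
  moreover have "rinv (Lbar D (g \<star> h)) = rinv (Lbar D g) * rinv (Lbar D h)"
    using assms red redm by (simp add: Lbar_eq rinv_mult prod_sq_unit)
  moreover have "Tb D g * (io D x * Tb D h) = io D x * (Tb D g * Tb D h)" for x
    by (rule io_left_commute)
  ultimately show ?thesis
    by (simp add: Tn_def io_mult mult.assoc)
qed

lemma Tn_prod_list:
  assumes "set gs \<subseteq> carrier V" "map \<pi> gs \<in> lists S" "reduced_expr G S (map \<pi> gs) (wprod G (map \<pi> gs))"
  shows "prod_list (map Tn gs) = Tn (wprod V gs)"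
  using assms
proof (induction gs)
  case Nil
  then show ?case
    using Lbar_eq[of "[]" "\<one>\<^bsub>V\<^esub>"] reduced_Nil by (simp add: Tn_def)
next
  case (Cons g gs)
  have "\<pi> (wprod V gs) = wprod G (map \<pi> gs)"
    using Cons.prems(1) by (induction gs) auto
  moreover have "reduced_expr G S (map \<pi> gs) (wprod G (map \<pi> gs))"
    using W.reduced_append(2)[of "[\<pi> g]" "map \<pi> gs"] Cons.prems by simp
  ultimately show ?case
    using Cons Tn_mult[of g "wprod V gs" "[\<pi> g]" "map \<pi> gs"] by simp
qed

lemma Tn_Om1_right: "g \<in> carrier V \<Longrightarrow> u \<in> Om1 D \<Longrightarrow> Tn (g \<star> u) = Tn g * Tb D u"
  by (simp add: Tn_def Lbar_def aff_part_mult_Omg Tb_Om1_right mult.assoc)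

lemma Tn_S: "g \<in> carrier V \<Longrightarrow> \<pi> g \<in> S \<Longrightarrow> Tn g = io D (rinv (sq D (\<pi> g))) * Tb D g"
  using Lbar_eq[of "[\<pi> g]" g] reduced_single[of "\<pi> g"] by (simp add: Tn_def)

lemma Tn_Om1_left:
  assumes "g \<in> carrier V" "\<pi> g \<in> S" "u \<in> Om1 D"
  shows "Tn (u \<star> g) = Tb D u * Tn g"
proof -
  have s': "\<pi> u \<cdot> \<pi> g \<cdot> winv (\<pi> u) \<in> S"
    using assms by (simp add: Omg_S)
  then have "Lbar D (u \<star> g) = sq D (\<pi> u \<cdot> \<pi> g \<cdot> winv (\<pi> u))"
    using Lbar_eq[of "[\<pi> u \<cdot> \<pi> g \<cdot> winv (\<pi> u)]" "u \<star> g"] assms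
    by (simp add: aff_part_Omg_left reduced_single)
  also have "\<dots> = sq D (\<pi> g)"
    using assms s' by (intro sq_commute[where x = "\<pi> u"]) (simp_all add: W.m_assoc)
  finally show ?thesis
    using assms Tn_S[of g] by (simp add: Tn_def Tb_Om1_left io_left_commute)
qed

subsection \<open>The group algebra of T\<close>

lemma emb_conj_act:
  assumes "rt_elem D c" "y \<in> carrier V"
  shows "emb D (conj_act D y c) = (\<Sum>t\<in>{t. c t \<noteq> 0}. io D (c t) * Tb D (y \<star> t \<star> vinv y))"
  unfolding emb_def
proof (rule sum.reindex_bij_witness[where i = "\<lambda>t. y \<star> t \<star> vinv y" and j = "\<lambda>t. vinv y \<star> t \<star> y"])
  have T: "t \<in> Tgrp D" if "c t \<noteq> 0" for t
    using assms that by (auto simp: rt_elem_def)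
  fix t
  assume "t \<in> {t. c t \<noteq> 0}"
  then have t: "t \<in> Tgrp D" "t \<in> carrier V" "c t \<noteq> 0"
    using T Tgrp_carrier by blast+
  show "vinv y \<star> (y \<star> t \<star> vinv y) \<star> y = t"
    using t assms by (simp add: V.m_assoc)
  then show "y \<star> t \<star> vinv y \<in> {t. conj_act D y c t \<noteq> 0}"
    using t assms by (simp add: conj_act_def)
next
  fix t
  assume "t \<in> {t. conj_act D y c t \<noteq> 0}"
  then have t: "t \<in> Tgrp D" "t \<in> carrier V" "c (vinv y \<star> t \<star> y) \<noteq> 0"
    using Tgrp_carrier by (auto simp: conj_act_def split: if_splits)
  show eq: "y \<star> (vinv y \<star> t \<star> y) \<star> vinv y = t"
    using t assms by (simp add: V.m_assoc)
  show "vinv y \<star> t \<star> y \<in> {t. c t \<noteq> 0}"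
    using t by simp
  show "io D (c (vinv y \<star> t \<star> y)) * Tb D (y \<star> (vinv y \<star> t \<star> y) \<star> vinv y) =
    io D (conj_act D y c t) * Tb D t"
    unfolding eq using t by (simp add: conj_act_def)
qed

lemma emb_transl:
  assumes "rt_elem D c" "y \<in> Tgrp D"
  shows "emb D (transl D y c) = Tb D y * emb D c"
proof -
  have T: "t \<in> Tgrp D" if "c t \<noteq> 0" for t
    using assms that by (auto simp: rt_elem_def)
  have "emb D (transl D y c) = (\<Sum>t\<in>{t. c t \<noteq> 0}. io D (c t) * Tb D (y \<star> t))"
    unfolding emb_def
  proof (rule sum.reindex_bij_witness[where i = "\<lambda>t. y \<star> t" and j = "\<lambda>t. vinv y \<star> t"])
    fix t
    assume "t \<in> {t. c t \<noteq> 0}"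
    then have t: "t \<in> Tgrp D" "t \<in> carrier V" "c t \<noteq> 0"
      using T Tgrp_carrier by blast+
    then show "vinv y \<star> (y \<star> t) = t" "y \<star> t \<in> {t. transl D y c t \<noteq> 0}"
      using assms by (simp_all add: transl_def)
  next
    fix t
    assume "t \<in> {t. transl D y c t \<noteq> 0}"
    then have t: "t \<in> Tgrp D" "t \<in> carrier V" "c (vinv y \<star> t) \<noteq> 0"
      using Tgrp_carrier by (auto simp: transl_def split: if_splits)
    then show "y \<star> (vinv y \<star> t) = t" "vinv y \<star> t \<in> {t. c t \<noteq> 0}"
      "io D (c (vinv y \<star> t)) * Tb D (y \<star> (vinv y \<star> t)) = io D (transl D y c t) * Tb D t"
      using assms by (simp_all add: transl_def)
  qed
  also have "\<dots> = Tb D y * emb D c"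
    unfolding emb_def sum_distrib_left
    using assms T by (intro sum.cong) (auto simp: Tb_Om1_right Tgrp_Om1 io_left_commute)
  finally show ?thesis .
qed

text \<open>Linear extension: a commutation rule with the elements of T carries over to R[T],
  because scalars are central.\<close>

lemma emb_intertwine:
  assumes "rt_elem D c" "y \<in> carrier V"
    and "\<And>t. t \<in> Tgrp D \<Longrightarrow> h * Tb D t = Tb D (y \<star> t \<star> vinv y) * h"
  shows "h * emb D c = emb D (conj_act D y c) * h"
  unfolding emb_conj_act[OF assms(1,2)]
  unfolding emb_def sum_distrib_left sum_distrib_right
  using assms by (intro sum.cong) (auto simp: rt_elem_def mult.assoc io_left_commute subset_iff)

text \<open>T is abelian, so it acts trivially on R[T].\<close>

lemma conj_act_T:
  assumes "rt_elem D c" "t \<in> Tgrp D" "w \<in> carrier V"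
  shows "conj_act D (t \<star> w) c = conj_act D w c"
proof
  fix x
  have "vinv (t \<star> w) \<star> x \<star> (t \<star> w) = vinv w \<star> x \<star> w" if "x \<in> Tgrp D"
  proof -
    have "vinv (t \<star> w) \<star> x \<star> (t \<star> w) = vinv w \<star> (vinv t \<star> (x \<star> t)) \<star> w"
      using that assms by (simp add: V.inv_mult_group V.m_assoc)
    then show ?thesis
      using Tgrp_comm[OF that assms(2)] that assms by simp
  qed
  then show "conj_act D (t \<star> w) c x = conj_act D w c x"
    by (simp add: conj_act_def)
qed

lemma conj_act_one: "rt_elem D c \<Longrightarrow> conj_act D \<one>\<^bsub>V\<^esub> c = c"
  by (auto simp: conj_act_def rt_elem_def fun_eq_iff subset_iff)

lemma rt_elem_conj_act:
  assumes "rt_elem D c" "y \<in> carrier V"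
  shows "rt_elem D (conj_act D y c)"
proof -
  have "{t. conj_act D y c t \<noteq> 0} \<subseteq> (\<lambda>t. y \<star> t \<star> vinv y) ` {t. c t \<noteq> 0}"
  proof
    fix t
    assume "t \<in> {t. conj_act D y c t \<noteq> 0}"
    then have t: "t \<in> Tgrp D" "c (vinv y \<star> t \<star> y) \<noteq> 0"
      by (auto simp: conj_act_def split: if_splits)
    then have "t = y \<star> (vinv y \<star> t \<star> y) \<star> vinv y"
      using assms by (simp add: V.m_assoc)
    then show "t \<in> (\<lambda>t. y \<star> t \<star> vinv y) ` {t. c t \<noteq> 0}"
      using t by blast
  qed
  moreover have "{t. conj_act D y c t \<noteq> 0} \<subseteq> Tgrp D"
    by (auto simp: conj_act_def split: if_splits)
  ultimately show ?thesis
    using assms finite_surj unfolding rt_elem_def by blast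
qed

lemma emb_Tb_commute:
  assumes "rt_elem D c" "t \<in> Tgrp D"
  shows "Tb D t * emb D c = emb D c * Tb D t"
proof -
  have "Tb D t * Tb D t' = Tb D (t \<star> t' \<star> vinv t) * Tb D t" if "t' \<in> Tgrp D" for t'
    using Tb_Om1_right[of t t'] Tb_Om1_right[of "t \<star> t' \<star> vinv t" t] assms that
    by (simp add: Tgrp_Om1 V.m_assoc)
  then have "Tb D t * emb D c = emb D (conj_act D t c) * Tb D t"
    using assms by (intro emb_intertwine) auto
  then show ?thesis
    using conj_act_T[of c t "\<one>\<^bsub>V\<^esub>"] assms by (simp add: conj_act_one)
qed

lemma transl_one: "rt_elem D c \<Longrightarrow> transl D \<one>\<^bsub>V\<^esub> c = c"
  by (auto simp: transl_def rt_elem_def fun_eq_iff subset_iff)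

text \<open>For t = s and w = n_s the parameter condition has trivial translation part and says that
  n_s fixes b_s under conjugation.\<close>

lemma Tb_n_emb: "s \<in> S \<Longrightarrow> Tb D (n s) * emb D (bp D s) = emb D (bp D s) * Tb D (n s)"
proof -
  assume s: "s \<in> S"
  have "Tb D (n s) * Tb D t = Tb D (n s \<star> t \<star> vinv (n s)) * Tb D (n s)" if "t \<in> Tgrp D" for t
  proof -
    have "Tb D (n s \<star> t) = Tb D (n s \<star> t \<star> vinv (n s) \<star> n s)"
      using s that by (simp add: V.m_assoc)
    then show ?thesis
      using Tb_Om1_right[of "n s" t] Tb_Om1_left[of "n s" "n s \<star> t \<star> vinv (n s)"] s that
      by (simp add: Tgrp_Om1)
  qed
  then have "Tb D (n s) * emb D (bp D s) = emb D (conj_act D (n s) (bp D s)) * Tb D (n s)"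
    using s by (intro emb_intertwine bp_rt) auto
  moreover have "conj_act D (n s) (bp D s) = bp D s"
    using bp_eq[of s s "n s"] s transl_one[OF rt_elem_conj_act[OF bp_rt[OF s]], of "n s"]
    by (simp add: V.m_assoc)
  ultimately show ?thesis
    by simp
qed

lemma conj_act_transl:
  assumes "t0 \<in> Tgrp D" "w \<in> carrier V"
  shows "conj_act D w (transl D t0 c) = transl D (w \<star> t0 \<star> vinv w) (conj_act D w c)"
proof
  fix t
  have "vinv w \<star> (vinv (w \<star> t0 \<star> vinv w) \<star> t) \<star> w = vinv t0 \<star> (vinv w \<star> t \<star> w)" if "t \<in> Tgrp D"
    using assms that by (simp add: V.inv_mult_group V.m_assoc)
  then show "conj_act D w (transl D t0 c) t = transl D (w \<star> t0 \<star> vinv w) (conj_act D w c) t"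
    using assms by (simp add: conj_act_def transl_def)
qed

lemma conj_act_mult:
  assumes "w \<in> carrier V" "x \<in> carrier V"
  shows "conj_act D w (conj_act D x c) = conj_act D (w \<star> x) c"
proof
  fix t
  have "vinv x \<star> (vinv w \<star> t \<star> w) \<star> x = vinv (w \<star> x) \<star> t \<star> (w \<star> x)" if "t \<in> Tgrp D"
    using assms that by (simp add: V.inv_mult_group V.m_assoc)
  then show "conj_act D w (conj_act D x c) t = conj_act D (w \<star> x) c t"
    using assms by (simp add: conj_act_def)
qed

text \<open>Comparison of two ways to write the same hyperplane, for the independence of
  \<open>Xi\<close> from its choices: with g and g' the two lifts of H, the conjugates of the
  parameters differ by the element g'^-1 g of T.\<close>

lemma emb_conj_bp:
  assumes "s \<in> S" "s' \<in> S" "w \<in> carrier V" "w' \<in> carrier V"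
    and eq: "\<pi> (w \<star> n s \<star> vinv w) = \<pi> (w' \<star> n s' \<star> vinv w')"
  shows "sq D s = sq D s'"
    and "w' \<star> vinv (n s') \<star> vinv w' \<star> (w \<star> n s \<star> vinv w) \<in> Tgrp D"
    and "emb D (conj_act D w (bp D s)) =
      emb D (conj_act D w' (bp D s')) * Tb D (w' \<star> vinv (n s') \<star> vinv w' \<star> (w \<star> n s \<star> vinv w))"
proof -
  define a where "a = winv (\<pi> w) \<cdot> \<pi> w'"
  have a: "a \<in> carrier G"
    using assms by (simp add: a_def)
  have "s \<cdot> a = winv (\<pi> w) \<cdot> (\<pi> w \<cdot> s \<cdot> winv (\<pi> w)) \<cdot> \<pi> w'"
    using assms(1-4) by (simp add: a_def W.m_assoc)
  also have "\<pi> w \<cdot> s \<cdot> winv (\<pi> w) = \<pi> w' \<cdot> s' \<cdot> winv (\<pi> w')"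
    using assms by simp
  also have "winv (\<pi> w) \<cdot> (\<pi> w' \<cdot> s' \<cdot> winv (\<pi> w')) \<cdot> \<pi> w' = a \<cdot> s'"
    using assms by (simp add: a_def W.m_assoc)
  finally have comm: "s \<cdot> a = a \<cdot> s'" .
  show "sq D s = sq D s'"
    using assms a comm by (intro sq_commute[where x = a]) auto
  define g where "g = w \<star> n s \<star> vinv w"
  define g' where "g' = w' \<star> n s' \<star> vinv w'"
  have gc: "g \<in> carrier V" "g' \<in> carrier V"
    using assms by (auto simp: g_def g'_def)
  have \<pi>g: "\<pi> g = \<pi> g'"
    using eq by (simp add: g_def g'_def)
  have ginv: "vinv g = w \<star> vinv (n s) \<star> vinv w" "vinv g' = w' \<star> vinv (n s') \<star> vinv w'"
    using assms by (simp_all add: g_def g'_def V.inv_mult_group V.m_assoc)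
  have g'g: "vinv g' \<star> g \<in> Tgrp D" "vinv g \<star> g' \<in> Tgrp D"
    using gc \<pi>g by (auto intro: TgrpI)
  show "w' \<star> vinv (n s') \<star> vinv w' \<star> (w \<star> n s \<star> vinv w) \<in> Tgrp D"
    using g'g by (simp add: ginv g_def)
  \<comment> \<open>A lift of a, chosen instead of w^-1 w' so that w x = g^-1 g' w' and the
    translation element, conjugated by w, is exactly g'^-1 g; the lift w^-1 w' would produce g
    g'^-1.\<close>
  define x where "x = vinv (n s) \<star> (vinv w \<star> w') \<star> n s'"
  have x: "x \<in> carrier V"
    using assms by (simp add: x_def)
  have "s \<cdot> \<pi> x = a \<cdot> s'"
    using assms by (simp add: x_def W.m_assoc a_def)
  moreover have "\<pi> x \<cdot> s' = winv s \<cdot> (a \<cdot> s') \<cdot> s'"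
    using assms by (simp add: x_def W.m_assoc a_def)
  moreover have "winv s \<cdot> (a \<cdot> s') = a"
    using assms a by (simp add: comm[symmetric])
  ultimately have \<pi>x: "s \<cdot> \<pi> x = \<pi> x \<cdot> s'"
    by simp
  define c0 where "c0 = n s \<star> x \<star> vinv (n s') \<star> vinv x"
  have b: "bp D s = transl D c0 (conj_act D x (bp D s'))"
    unfolding c0_def using assms x \<pi>x by (intro bp_eq[symmetric]) auto
  have c0T: "c0 \<in> Tgrp D"
    using assms x by (intro TgrpI) (simp_all add: c0_def \<pi>x W.m_assoc)
  have "w \<star> c0 \<star> vinv w = vinv g' \<star> g"
    using assms by (simp add: c0_def x_def ginv g_def V.inv_mult_group V.m_assoc)
  moreover have "w \<star> x = vinv g \<star> g' \<star> w'"
    using assms by (simp add: ginv g'_def x_def V.m_assoc)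
  ultimately have "conj_act D w (bp D s) = transl D (vinv g' \<star> g) (conj_act D w' (bp D s'))"
    using assms x c0T g'g bp_rt[of s']
    by (subst b) (simp add: conj_act_transl conj_act_mult conj_act_T)
  then show "emb D (conj_act D w (bp D s)) =
      emb D (conj_act D w' (bp D s')) * Tb D (w' \<star> vinv (n s') \<star> vinv w' \<star> (w \<star> n s \<star> vinv w))"
    using assms g'g by (simp add: emb_transl emb_Tb_commute rt_elem_conj_act bp_rt ginv[symmetric] g_def[symmetric])
qed

section \<open>The normalized factors and their products along galleries\<close>

definition factor :: "int \<Rightarrow> 'w \<Rightarrow> 'h" where
  "factor e s = io D (rinv (sq D s)) * (if e = 1 then Tb D (n s) else Tb D (n s) - emb D (bp D s))"

lemma factor_one: "s \<in> S \<Longrightarrow> factor 1 s = Tn (n s)"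
  by (simp add: factor_def Tn_S)

lemma factor_diff: "s \<in> S \<Longrightarrow> factor 1 s - factor (-1) s = io D (rinv (sq D s)) * emb D (bp D s)"
  by (simp add: factor_def algebra_simps)

lemma rinv_sq: "s \<in> S \<Longrightarrow> rinv (sq D s) * rinv (sq D s) * ap D s = 1"
  using rinv_right[OF sq_unit[of s]] sq_sq[of s]
  by (metis mult.assoc mult.commute mult.right_neutral)

lemma factor_inverse:
  assumes "s \<in> S"
  shows "factor 1 s * factor (-1) s = Tb D (n s \<star> n s)"
    and "factor (-1) s * factor 1 s = Tb D (n s \<star> n s)"
proof -
  let ?c = "io D (rinv (sq D s))" and ?Y = "Tb D (n s) - emb D (bp D s)"
  have 1: "?c * x * (?c * y) = io D (rinv (sq D s) * rinv (sq D s)) * (x * y)" for x y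
    using io_left_commute[of x "rinv (sq D s)" y] by (simp add: io_mult mult.assoc)
  have 2: "io D (rinv (sq D s) * rinv (sq D s)) * (io D (ap D s) * x) = x" for x
    using rinv_sq[OF assms] by (simp add: io_mult[symmetric] mult.assoc[symmetric])
  \<comment> \<open>Both products give a_s T_(n_s^2) by the quadratic relation; the second order
    uses that T_(n_s) commutes with b_s. The scalar a_s then cancels against the two square
    roots.\<close>
  have "Tb D (n s) * ?Y = io D (ap D s) * Tb D (n s \<star> n s)" "?Y * Tb D (n s) = io D (ap D s) * Tb D (n s \<star> n s)"
    using Tb_quad[OF assms] Tb_n_emb[OF assms] by (simp_all add: algebra_simps)
  then show "factor 1 s * factor (-1) s = Tb D (n s \<star> n s)"
    and "factor (-1) s * factor 1 s = Tb D (n s \<star> n s)"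
    by (simp_all add: factor_def 1 2)
qed

lemma n_sq_T: "s \<in> S \<Longrightarrow> n s \<star> n s \<in> Tgrp D"
  by (intro TgrpI) (simp_all add: W.S_sq)

lemma factor_sq:
  "s \<in> S \<Longrightarrow> e = 1 \<or> e = -1 \<Longrightarrow> factor e s * factor (- e) s = Tb D (n s \<star> n s)"
  using factor_inverse by auto

text \<open>Both factors are normalized basis elements or inverses of such, so all commutation rules
  for the factors reduce to products of basis elements with additive lengths.\<close>

lemma factor_minus_inverse:
  assumes "s \<in> S"
  shows "factor (-1) s * Tn (vinv (n s)) = 1" "Tn (vinv (n s)) * factor (-1) s = 1"
proof -
  define t where "t = n s \<star> n s"
  have t: "t \<in> Tgrp D" "t \<in> carrier V"
    using n_sq_T[OF assms] by (auto simp: t_def)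
  \<comment> \<open>The inverse of n_s is n_s corrected by an element of T on either side, so
    inverses up to T_(n_s^2) become genuine inverses.\<close>
  have inv1: "vinv (n s) = n s \<star> vinv t" and inv2: "vinv (n s) = vinv t \<star> n s"
    using assms by (simp_all add: t_def V.inv_mult_group V.m_assoc)
  have Tn1: "Tn (vinv (n s)) = Tn (n s) * Tb D (vinv t)"
    unfolding inv1 using assms t by (intro Tn_Om1_right) (simp_all add: Tgrp_Om1)
  have Tn2: "Tn (vinv (n s)) = Tb D (vinv t) * Tn (n s)"
    unfolding inv2 using assms t by (intro Tn_Om1_left) (simp_all add: Tgrp_Om1)
  have tt: "Tb D t * Tb D (vinv t) = 1" "Tb D (vinv t) * Tb D t = 1"
    using Tb_Om1_inv[of t] Tb_Om1_inv[of "vinv t"] t by simp_all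
  show "factor (-1) s * Tn (vinv (n s)) = 1"
    unfolding Tn1 using factor_inverse(2)[OF assms] tt
    by (simp add: factor_one[OF assms, symmetric] mult.assoc[symmetric] t_def)
  show "Tn (vinv (n s)) * factor (-1) s = 1"
    unfolding Tn2 using factor_inverse(1)[OF assms] tt
    by (simp add: factor_one[OF assms, symmetric] mult.assoc t_def)
qed

primrec gal :: "('w \<Rightarrow> 'w \<Rightarrow> int) \<Rightarrow> 'w \<Rightarrow> 'w list \<Rightarrow> 'h" where
  "gal f v [] = 1"
| "gal f v (s # xs) = factor (f v s) s * gal f (v \<cdot> s) xs"

lemma gal_append: "v \<in> carrier G \<Longrightarrow> xs \<in> lists S \<Longrightarrow> ys \<in> lists S \<Longrightarrow>
    gal f v (xs @ ys) = gal f v xs * gal f (v \<cdot> wprod G xs) ys"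
  by (induction xs arbitrary: v) (simp_all add: mult.assoc W.m_assoc)

lemma gal_signs: "gal f v xs = prod_list (map2 factor (signs G f v xs) xs)"
  by (induction xs arbitrary: v) simp_all

text \<open>The word that appears when u is moved from the left of \<open>xs\<close> to its
  right.\<close>

definition slid :: "'v \<Rightarrow> 'w list \<Rightarrow> 'w list" where
  "slid u xs = map (\<lambda>s. \<pi> u \<cdot> s \<cdot> winv (\<pi> u)) xs"

lemma slid_lists: "u \<in> Om1 D \<Longrightarrow> xs \<in> lists S \<Longrightarrow> slid u xs \<in> lists S"
  using Omg_S[OF Om1_pi] by (auto simp: slid_def)

lemma slid_T: "t \<in> Tgrp D \<Longrightarrow> xs \<in> lists S \<Longrightarrow> slid t xs = xs"
  unfolding slid_def by (induction xs) simp_all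

text \<open>For the plus sign this is u n_s = n_(s') u' with additive lengths. The minus sign
  follows from the same rule for inverses.\<close>

lemma factor_slide:
  assumes "u \<in> Om1 D" "s \<in> S" "s' = \<pi> u \<cdot> s \<cdot> winv (\<pi> u)" "e = 1 \<or> e = -1"
  shows "Tb D u * factor e s = factor e s' * Tb D (vinv (n s') \<star> u \<star> n s)"
proof -
  define u' where "u' = vinv (n s') \<star> u \<star> n s"
  have s': "s' \<in> S"
    using assms Omg_S by simp
  have \<pi>u': "\<pi> u' = \<pi> u"
  proof -
    have "\<pi> u' = winv s' \<cdot> (s' \<cdot> \<pi> u)"
      using assms(1,2) s' by (simp add: u'_def assms(3) W.m_assoc)
    then show ?thesis
      using assms s' by simp
  qed
  have u': "u' \<in> Om1 D"
    using assms s' \<pi>u' by (intro Om1I) (simp_all add: u'_def)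
  have "Tb D u * factor 1 s = factor 1 s' * Tb D u'"
  proof -
    have "u \<star> n s = n s' \<star> u'"
      using assms s' by (simp add: u'_def V.m_assoc)
    then show ?thesis
      using Tn_Om1_left[of "n s" u] Tn_Om1_right[of "n s'" u'] assms s' u' by (simp add: factor_one)
  qed
  moreover have "Tb D u * factor (-1) s = factor (-1) s' * Tb D u'"
  proof -
    have "u' \<star> vinv (n s) = vinv (n s') \<star> u"
      using assms s' by (simp add: u'_def V.m_assoc)
    \<comment> \<open>The rule for the inverses of the two minus factors; multiplying it by one
      minus factor on each side gives the claim.\<close>
    then have eq: "Tb D u' * Tn (vinv (n s)) = Tn (vinv (n s')) * Tb D u"
      using Tn_Om1_left[of "vinv (n s)" u'] Tn_Om1_right[of "vinv (n s')" u] assms s' u'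
      by (simp add: W.S_inv)
    have "Tb D u * factor (-1) s = factor (-1) s' * (Tn (vinv (n s')) * Tb D u) * factor (-1) s"
      using factor_minus_inverse(1)[OF s'] by (simp add: mult.assoc[symmetric])
    also have "\<dots> = factor (-1) s' * Tb D u' * (Tn (vinv (n s)) * factor (-1) s)"
      by (simp only: eq[symmetric] mult.assoc)
    finally show ?thesis
      using factor_minus_inverse(2)[OF assms(2)] by simp
  qed
  ultimately show ?thesis
    using assms(4) by (auto simp: u'_def)
qed

text \<open>An element of length zero passes through a gallery product. The last clause of
  \<open>oriented\<close> makes the signs seen from v pi(u) along \<open>xs\<close> equal to those
  seen from v along the conjugated word; the element that emerges is dictated by the corresponding
  identity in the pro-p group.\<close>

lemma gal_slide:
  assumes f: "oriented f"
  shows "\<lbrakk>u \<in> Om1 D; xs \<in> lists S; v \<in> carrier G\<rbrakk> \<Longrightarrow>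
    vinv (N (slid u xs)) \<star> u \<star> N xs \<in> Om1 D \<and>
    Tb D u * gal f (v \<cdot> \<pi> u) xs = gal f v (slid u xs) * Tb D (vinv (N (slid u xs)) \<star> u \<star> N xs)"
proof (induction xs arbitrary: u v)
  case (Cons s xs)
  define s' where "s' = \<pi> u \<cdot> s \<cdot> winv (\<pi> u)"
  define u' where "u' = vinv (n s') \<star> u \<star> n s"
  have mem: "s \<in> S" "xs \<in> lists S" "s' \<in> S" "slid u xs \<in> lists S"
    using Cons.prems Omg_S[of "\<pi> u" s] slid_lists[of u xs] by (auto simp: s'_def)
  have shift: "s' \<cdot> \<pi> u = \<pi> u \<cdot> s"
    using Cons.prems mem by (simp add: s'_def W.m_assoc)
  have \<pi>u': "\<pi> u' = \<pi> u"
  proof -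
    have "\<pi> u' = winv s' \<cdot> (s' \<cdot> \<pi> u)"
      using Cons.prems mem by (simp add: u'_def shift W.m_assoc)
    then show ?thesis
      using Cons.prems mem by simp
  qed
  have u': "u' \<in> Om1 D"
    using Cons.prems mem \<pi>u' by (intro Om1I) (simp_all add: u'_def)
  have sl: "slid u' xs = slid u xs" "slid u (s # xs) = s' # slid u xs"
    by (simp_all add: slid_def \<pi>u' s'_def)
  have IH: "vinv (N (slid u xs)) \<star> u' \<star> N xs \<in> Om1 D"
    "Tb D u' * gal f (v \<cdot> s' \<cdot> \<pi> u) xs =
      gal f (v \<cdot> s') (slid u xs) * Tb D (vinv (N (slid u xs)) \<star> u' \<star> N xs)"
    using Cons.IH[OF u', of "v \<cdot> s'"] Cons.prems mem by (simp_all add: sl \<pi>u')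
  have u'': "vinv (N (slid u (s # xs))) \<star> u \<star> N (s # xs) = vinv (N (slid u xs)) \<star> u' \<star> N xs"
    using Cons.prems mem by (simp add: sl u'_def V.inv_mult_group V.m_assoc)
  have "f (v \<cdot> \<pi> u) s = f v s'"
    using oriented_Omg[OF f] Cons.prems mem by (simp add: s'_def)
  moreover have "v \<cdot> \<pi> u \<cdot> s = v \<cdot> s' \<cdot> \<pi> u"
    using Cons.prems mem by (simp add: W.m_assoc shift)
  ultimately have "Tb D u * gal f (v \<cdot> \<pi> u) (s # xs) =
      Tb D u * factor (f v s') s * gal f (v \<cdot> s' \<cdot> \<pi> u) xs"
    by (simp add: mult.assoc)
  also have "Tb D u * factor (f v s') s = factor (f v s') s' * Tb D u'"
    unfolding u'_def
    using Cons.prems mem s'_def oriented_sign[OF f, of v s'] by (intro factor_slide) auto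
  also have "factor (f v s') s' * Tb D u' * gal f (v \<cdot> s' \<cdot> \<pi> u) xs =
      gal f v (slid u (s # xs)) * Tb D (vinv (N (slid u xs)) \<star> u' \<star> N xs)"
    using IH by (simp add: mult.assoc sl)
  finally show ?case
    using IH u'' by simp
qed (simp add: slid_def)

section \<open>Braid invariance of gallery products\<close>

definition prods :: "int \<Rightarrow> 'w list \<Rightarrow> 'h" where
  "prods e xs = prod_list (map (factor e) xs)"

text \<open>The inverse of \<open>prods (-1) xs\<close>, written with normalized basis elements so
  that it can merge with plus factors.\<close>

definition inv_prods :: "'w list \<Rightarrow> 'h" where
  "inv_prods xs = prod_list (map (\<lambda>s. Tn (vinv (n s))) (rev xs))"

lemma inv_prods: "xs \<in> lists S \<Longrightarrow> prods (-1) xs * inv_prods xs = 1 \<and> inv_prods xs * prods (-1) xs = 1"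
proof (induction xs)
  case (Cons s xs)
  let ?f = "factor (-1) s" and ?i = "Tn (vinv (n s))"
  have "?f * prods (-1) xs * (inv_prods xs * ?i) = ?f * (prods (-1) xs * inv_prods xs) * ?i"
    "inv_prods xs * ?i * (?f * prods (-1) xs) = inv_prods xs * (?i * ?f) * prods (-1) xs"
    by (simp_all only: mult.assoc)
  then show ?case
    using Cons factor_minus_inverse[of s] by (simp add: prods_def inv_prods_def)
qed (simp add: prods_def inv_prods_def)

lemma wprod_inv_n: "xs \<in> lists S \<Longrightarrow> wprod V (map (\<lambda>s. vinv (n s)) (rev xs)) = vinv (N xs)"
proof (induction xs)
  case (Cons s xs)
  have "set (map (\<lambda>s. vinv (n s)) (rev xs)) \<subseteq> carrier V"
    using Cons.prems by auto
  then show ?case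
    using Cons by (simp add: V.wprod_append V.inv_mult_group)
qed simp

lemma map_pi: "xs \<in> lists S \<Longrightarrow> map \<pi> (map n xs) = xs"
  "xs \<in> lists S \<Longrightarrow> map \<pi> (map (\<lambda>s. vinv (n s)) xs) = xs"
  by (induction xs) (simp_all add: W.S_inv)

text \<open>Each inverse of n_s again lies above s, so the whole product follows the reduced word
  \<open>rev b @ a\<close> and collapses to one normalized basis element.\<close>

lemma inv_prods_mult:
  assumes "a \<in> lists S" "b \<in> lists S" "reduced_expr G S (rev b @ a) (wprod G (rev b @ a))"
  shows "inv_prods b * prods 1 a = Tn (vinv (N b) \<star> N a)"
proof -
  let ?g = "map (\<lambda>s. vinv (n s)) (rev b) @ map n a"
  have g: "set ?g \<subseteq> carrier V" "map \<pi> ?g = rev b @ a"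
    using assms map_pi(1)[of a] map_pi(2)[of "rev b"] by auto
  have "prods 1 a = prod_list (map (\<lambda>s. Tn (n s)) a)"
    unfolding prods_def using assms(1) by (intro arg_cong[where f = prod_list] map_cong) (auto simp: factor_one)
  then have "inv_prods b * prods 1 a = prod_list (map Tn ?g)"
    by (simp add: inv_prods_def comp_def)
  also have "\<dots> = Tn (wprod V ?g)"
    using g assms by (intro Tn_prod_list) (simp_all only:, simp)
  also have "wprod V ?g = vinv (N b) \<star> N a"
    using g assms by (simp add: V.wprod_append wprod_inv_n N_def)
  finally show ?thesis .
qed

lemma mult_inv_prods:
  assumes "a \<in> lists S" "b \<in> lists S" "reduced_expr G S (a @ rev b) (wprod G (a @ rev b))"
  shows "prods 1 a * inv_prods b = Tn (N a \<star> vinv (N b))"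
proof -
  let ?g = "map n a @ map (\<lambda>s. vinv (n s)) (rev b)"
  have g: "set ?g \<subseteq> carrier V" "map \<pi> ?g = a @ rev b"
    using assms map_pi(1)[of a] map_pi(2)[of "rev b"] by auto
  have "prods 1 a = prod_list (map (\<lambda>s. Tn (n s)) a)"
    unfolding prods_def using assms(1) by (intro arg_cong[where f = prod_list] map_cong) (auto simp: factor_one)
  then have "prods 1 a * inv_prods b = prod_list (map Tn ?g)"
    by (simp add: inv_prods_def comp_def)
  also have "\<dots> = Tn (wprod V ?g)"
    using g assms by (intro Tn_prod_list) (simp_all only:, simp)
  also have "wprod V ?g = N a \<star> vinv (N b)"
    using g assms by (simp add: V.wprod_append wprod_inv_n N_def)
  finally show ?thesis .
qed

text \<open>Multiplying by the inverses of both minus blocks leaves plus factors and inverses only.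
  By reducedness each side is then a single normalized basis element, at N(b')^-1 N(a) and N(a')
  N(b)^-1, and these group elements agree.\<close>

lemma prods_exchange:
  assumes "a \<in> lists S" "b \<in> lists S" "a' \<in> lists S" "b' \<in> lists S"
    and N: "N (a @ b) = N (b' @ a')"
    and red: "reduced_expr G S (rev b' @ a) (wprod G (rev b' @ a))"
      "reduced_expr G S (a' @ rev b) (wprod G (a' @ rev b))"
  shows "prods 1 a * prods (-1) b = prods (-1) b' * prods 1 a'"
proof -
  have "vinv (N b') \<star> (N a \<star> N b) \<star> vinv (N b) = vinv (N b') \<star> (N b' \<star> N a') \<star> vinv (N b)"
    using N assms by (simp add: N_append)
  then have "vinv (N b') \<star> N a = N a' \<star> vinv (N b)"
    using assms(1-4) by (simp add: V.m_assoc)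
  then have eq: "inv_prods b' * prods 1 a = prods 1 a' * inv_prods b"
    using assms by (simp add: inv_prods_mult mult_inv_prods)
  have "prods 1 a * prods (-1) b = (prods (-1) b' * inv_prods b') * prods 1 a * prods (-1) b"
    using inv_prods assms by simp
  also have "\<dots> = prods (-1) b' * (inv_prods b' * prods 1 a) * prods (-1) b"
    by (simp only: mult.assoc)
  also have "\<dots> = prods (-1) b' * prods 1 a' * (inv_prods b * prods (-1) b)"
    by (simp only: eq mult.assoc)
  finally show ?thesis
    using inv_prods assms by simp
qed

lemma gal_split:
  assumes "signs G f v xs = replicate k e @ replicate j e'" "length xs = k + j"
  shows "gal f v xs = prods e (take k xs) * prods e' (drop k xs)"
proof -
  have "map2 factor (signs G f v xs) xs =
      map2 factor (replicate k e @ replicate j e') (take k xs @ drop k xs)"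
    by (simp add: assms)
  also have "\<dots> = map (factor e) (take k xs) @ map (factor e') (drop k xs)"
    using assms(2) by (subst zip_append) (simp_all add: map2_replicate)
  finally show ?thesis
    by (simp add: gal_signs prods_def)
qed

lemma reduced_alt:
  assumes "s \<in> S" "t \<in> S" "k \<le> cox_m G s t"
  shows "reduced_expr G S (alt_word s t k) (wprod G (alt_word s t k))"
  using assms W.distinct_refls_alt[of s t "\<one>\<^bsub>G\<^esub>" k] alt_word_lists[of s S t k]
  by (intro W.distinct_reduced) simp_all

lemma gal_braid_aux:
  assumes "s \<in> S" "t \<in> S" "s \<noteq> t" "cox_m G s t > 0" "m = cox_m G s t" "k \<le> m"
    and "signs G f v (alt_word s t m) = replicate k 1 @ replicate (m - k) (-1)"
    and "signs G f v (alt_word t s m) = replicate (m - k) (-1) @ replicate k 1"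
  shows "gal f v (alt_word s t m) = gal f v (alt_word t s m)"
proof -
  define j where "j = m - k"
  have m: "m = k + j"
    using assms by (simp add: j_def)
  let ?a = "take k (alt_word s t m)" and ?b = "drop k (alt_word s t m)"
    and ?b' = "take j (alt_word t s m)" and ?a' = "drop j (alt_word t s m)"
  have mem: "alt_word s t i \<in> lists S" "alt_word t s i \<in> lists S" for i
    using assms alt_word_lists[of s S t i] alt_word_lists[of t S s i] by simp_all
  have red: "reduced_expr G S (alt_word s t m) (wprod G (alt_word s t m))"
    "reduced_expr G S (alt_word t s m) (wprod G (alt_word t s m))"
    using assms W.cox_m_commute[of s t] by (auto intro: reduced_alt)
  have words: "?a = alt_word s t k" "?b' = alt_word t s j"
    "?b = (if even k then alt_word s t j else alt_word t s j)"
    "?a' = (if even j then alt_word t s k else alt_word s t k)"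
    by (simp_all add: m take_alt_word drop_alt_word)
  have "gal f v (alt_word s t m) = prods 1 ?a * prods (-1) ?b"
    using assms(7) by (intro gal_split[where j = j]) (simp_all add: m)
  also have "\<dots> = prods (-1) ?b' * prods 1 ?a'"
  proof (rule prods_exchange)
    show "N (?a @ ?b) = N (?b' @ ?a')"
      using N_braid[of s t] assms by simp
    \<comment> \<open>The two braid words begin with different letters and end with different
      letters, so both regrouped words are again alternating of length m, hence reduced.\<close>
    have "rev ?b' @ ?a = (if even j then alt_word s t m else alt_word t s m)"
      unfolding words by (simp add: m add.commute[of k] rev_alt_word alt_word_add)
    then show "reduced_expr G S (rev ?b' @ ?a) (wprod G (rev ?b' @ ?a))"
      using red by simp
    have "?a' @ rev ?b = (if even j then alt_word t s m else alt_word s t m)"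
      unfolding words by (simp add: m rev_alt_word alt_word_add)
    then show "reduced_expr G S (?a' @ rev ?b) (wprod G (?a' @ rev ?b))"
      using red by simp
  qed (use mem words in simp_all)
  also have "\<dots> = gal f v (alt_word t s m)"
    using assms(8) by (intro gal_split[symmetric]) (simp_all add: m)
  finally show ?thesis .
qed

lemma gal_braid:
  assumes "oriented f" "v \<in> carrier G" "s \<in> S" "t \<in> S" "s \<noteq> t" "cox_m G s t > 0"
  shows "gal f v (alt_word s t (cox_m G s t)) = gal f v (alt_word t s (cox_m G s t))"
proof (rule oriented_braid[OF assms(1-4,6) refl])
  fix k
  assume "k \<le> cox_m G s t"
    "signs G f v (alt_word s t (cox_m G s t)) = replicate (cox_m G s t - k) (-1) @ replicate k 1"
    "signs G f v (alt_word t s (cox_m G s t)) = replicate k 1 @ replicate (cox_m G s t - k) (-1)"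
  \<comment> \<open>The second pattern of (OR2) is the first one with s and t interchanged.\<close>
  then show ?thesis
    using W.cox_m_commute[of s t] assms by (intro gal_braid_aux[of t s _ k, symmetric]) simp_all
qed (use assms gal_braid_aux in blast)

lemma gal_T:
  assumes "oriented f" "t \<in> Tgrp D" "xs \<in> lists S" "v \<in> carrier G"
  shows "Tb D t * gal f v xs = gal f v xs * Tb D (vinv (N xs) \<star> t \<star> N xs)"
  using gal_slide[OF assms(1) Tgrp_Om1[OF assms(2)] assms(3,4)] assms by (simp add: slid_T)

text \<open>Words with equal product in W have lifts that differ by some t in T, and the gallery
  products differ by T_t for the same t. It is 1 for a braid move and n_s^2 for a square; its
  independence of v allows moves inside a longer word.\<close>

lemma gal_cong:
  assumes f: "oriented f" and "wprod G xs = wprod G ys" "xs \<in> lists S" "ys \<in> lists S"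
  shows "\<exists>t\<in>Tgrp D. N xs = N ys \<star> t \<and> (\<forall>v\<in>carrier G. gal f v xs = gal f v ys * Tb D t)"
  using assms(2-)
proof (induction xs ys rule: W.cox_equiv_induct)
  case (refl xs)
  then show ?case
    by (intro bexI[of _ "\<one>\<^bsub>V\<^esub>"]) simp_all
next
  case (sym xs ys)
  then obtain t where t: "t \<in> Tgrp D" "N xs = N ys \<star> t" "\<And>v. v \<in> carrier G \<Longrightarrow> gal f v xs = gal f v ys * Tb D t"
    by blast
  show ?case
    using t sym Tb_Om1_inv[of t]
    by (intro bexI[of _ "vinv t"]) (simp_all add: V.m_assoc mult.assoc)
next
  case (trans xs ys zs)
  then obtain t t' where t: "t \<in> Tgrp D" "N xs = N ys \<star> t" "\<And>v. v \<in> carrier G \<Longrightarrow> gal f v xs = gal f v ys * Tb D t"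
    "t' \<in> Tgrp D" "N ys = N zs \<star> t'" "\<And>v. v \<in> carrier G \<Longrightarrow> gal f v ys = gal f v zs * Tb D t'"
    by blast
  show ?case
    using t trans
    by (intro bexI[of _ "t' \<star> t"]) (simp_all add: V.m_assoc mult.assoc Tb_Om1_right Tgrp_Om1)
next
  case (append us vs xs ys)
  then obtain t where t: "t \<in> Tgrp D" "N xs = N ys \<star> t" "\<And>v. v \<in> carrier G \<Longrightarrow> gal f v xs = gal f v ys * Tb D t"
    by blast
  show ?case
  proof (intro bexI[of _ "vinv (N vs) \<star> t \<star> N vs"] conjI ballI)
    show "N (us @ xs @ vs) = N (us @ ys @ vs) \<star> (vinv (N vs) \<star> t \<star> N vs)"
      using t append by (simp add: N_append V.m_assoc)
    fix v
    assume v: "v \<in> carrier G"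
    have "gal f v (us @ xs @ vs) =
        gal f v us * (gal f (v \<cdot> wprod G us) ys * (Tb D t * gal f (v \<cdot> wprod G us \<cdot> wprod G ys) vs))"
      using t append v by (simp add: gal_append mult.assoc)
    \<comment> \<open>The correction t passes through the suffix and is conjugated on the way,
      exactly as in the group identity for the lifts.\<close>
    also have "\<dots> = gal f v (us @ ys @ vs) * Tb D (vinv (N vs) \<star> t \<star> N vs)"
      using t append v f by (simp add: gal_append gal_T mult.assoc)
    finally show "gal f v (us @ xs @ vs) = gal f v (us @ ys @ vs) * Tb D (vinv (N vs) \<star> t \<star> N vs)" .
  qed (use t append in simp)
next
  case (square s)
  have "gal f v [s, s] = Tb D (n s \<star> n s)" if "v \<in> carrier G" for v
    using factor_sq[of s "f v s"] oriented_sign[OF f that square] oriented_flip[OF f that square] square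
    by simp
  then show ?case
    using square n_sq_T[of s] by (intro bexI[of _ "n s \<star> n s"]) simp_all
next
  case (braid s t)
  then show ?case
    using gal_braid[OF f, of _ s t] N_braid[of s t] alt_word_lists[of t S s]
    by (intro bexI[of _ "\<one>\<^bsub>V\<^esub>"]) simp_all
qed

subsection \<open>The normalized Bernstein map as a cocycle\<close>

text \<open>The decomposition ranges over all words, so the rule for products can concatenate words
  whose lengths do not add.\<close>

definition Theta :: "('w \<Rightarrow> 'w \<Rightarrow> int) \<Rightarrow> 'w \<Rightarrow> 'v \<Rightarrow> 'h" where
  "Theta f v w = (SOME x. \<exists>xs\<in>lists S. \<exists>u\<in>Om1 D. w = N xs \<star> u \<and> x = gal f v xs * Tb D u)"

lemma Theta_eq:
  assumes f: "oriented f" and "v \<in> carrier G" "xs \<in> lists S" "u \<in> Om1 D"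
  shows "Theta f v (N xs \<star> u) = gal f v xs * Tb D u"
  unfolding Theta_def
proof (rule some_equality)
  fix x
  assume "\<exists>ys\<in>lists S. \<exists>u'\<in>Om1 D. N xs \<star> u = N ys \<star> u' \<and> x = gal f v ys * Tb D u'"
  then obtain ys u' where ys: "ys \<in> lists S" "u' \<in> Om1 D" "N xs \<star> u = N ys \<star> u'" "x = gal f v ys * Tb D u'"
    by blast
  have "wprod G xs \<cdot> \<pi> u = \<pi> (N xs \<star> u)"
    using assms by simp
  also have "\<dots> = wprod G ys \<cdot> \<pi> u'"
    unfolding ys(3) using ys by simp
  finally have "wprod G xs = wprod G ys"
    by (rule decomp_unique(1)[OF W.wprod_lists_Wa W.wprod_lists_Wa Om1_pi Om1_pi, rotated 4])
      (use assms ys in blast)+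
  then obtain t where t: "t \<in> Tgrp D" "N xs = N ys \<star> t" "gal f v xs = gal f v ys * Tb D t"
    using gal_cong[OF f, of xs ys] assms ys by blast
  \<comment> \<open>The discrepancy between the two lifted words is compensated by the length-zero
    parts: t u = u'.\<close>
  have "N ys \<star> (t \<star> u) = N ys \<star> u'"
    using ys t assms by (simp add: V.m_assoc)
  then have "t \<star> u = u'"
    using ys t assms by simp
  then have "Tb D u' = Tb D t * Tb D u"
    using t assms Tb_Om1_right by auto
  then show "x = gal f v xs * Tb D u"
    using t ys by (simp add: mult.assoc)
qed (use assms in blast)

lemma Theta_T: "oriented f \<Longrightarrow> v \<in> carrier G \<Longrightarrow> t \<in> Tgrp D \<Longrightarrow> Theta f v t = Tb D t"
  using Theta_eq[of f v "[]" t] by (simp add: Tgrp_Om1)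

lemma Theta_mult:
  assumes f: "oriented f" and v: "v \<in> carrier G" and w: "w \<in> carrier V" "w' \<in> carrier V"
  shows "Theta f v (w \<star> w') = Theta f v w * Theta f (v \<cdot> \<pi> w) w'"
proof -
  obtain xs u where 1: "xs \<in> lists S" "u \<in> Om1 D" "w = N xs \<star> u"
    by (rule Om1_decomp[OF w(1)]) (auto simp: reduced_expr_def)
  obtain ys u' where 2: "ys \<in> lists S" "u' \<in> Om1 D" "w' = N ys \<star> u'"
    by (rule Om1_decomp[OF w(2)]) (auto simp: reduced_expr_def)
  \<comment> \<open>What remains of u after it has passed the word \<open>ys\<close>.\<close>
  define x where "x = vinv (N (slid u ys)) \<star> u \<star> N ys"
  have sl: "slid u ys \<in> lists S"
    using 1 2 slid_lists by blast
  have x: "x \<in> Om1 D"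
    "Tb D u * gal f (v \<cdot> wprod G xs \<cdot> \<pi> u) ys = gal f (v \<cdot> wprod G xs) (slid u ys) * Tb D x"
    using gal_slide[OF f 1(2) 2(1), of "v \<cdot> wprod G xs"] v 1 by (simp_all add: x_def)
  have "w \<star> w' = N (xs @ slid u ys) \<star> (x \<star> u')"
    using 1 2 sl by (simp add: N_append x_def V.m_assoc)
  then have "Theta f v (w \<star> w') = gal f v (xs @ slid u ys) * Tb D (x \<star> u')"
    using f v 1 2 x sl by (simp only:) (intro Theta_eq; simp)
  also have "\<dots> = gal f v xs * (gal f (v \<cdot> wprod G xs) (slid u ys) * Tb D x) * Tb D u'"
    using 1 2 v sl x by (simp add: gal_append Tb_Om1_right mult.assoc)
  also have "\<dots> = (gal f v xs * Tb D u) * (gal f (v \<cdot> \<pi> w) ys * Tb D u')"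
    using 1 v by (simp only: x(2)[symmetric]) (simp add: mult.assoc W.m_assoc)
  also have "\<dots> = Theta f v w * Theta f (v \<cdot> \<pi> w) w'"
    using f v w 1 2 by (simp only: Theta_eq pi.hom_closed W.m_closed)
  finally show ?thesis .
qed

lemma gal_translate:
  assumes "\<And>v s. v \<in> carrier G \<Longrightarrow> s \<in> S \<Longrightarrow> f (x \<cdot> v) s = f' v s" "x \<in> carrier G"
  shows "v \<in> carrier G \<Longrightarrow> xs \<in> lists S \<Longrightarrow> gal f (x \<cdot> v) xs = gal f' v xs"
  by (induction xs arbitrary: v) (simp_all add: assms W.m_assoc)

text \<open>Translating the base chamber on the left amounts to acting on the orientation; this is
  the form in which adjacency enters the cocycle.\<close>

lemma Theta_translate:
  assumes "oriented f" "oriented f'"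
    and "\<And>v s. v \<in> carrier G \<Longrightarrow> s \<in> S \<Longrightarrow> f (x \<cdot> v) s = f' v s" "x \<in> carrier G" "v \<in> carrier G" "w \<in> carrier V"
  shows "Theta f (x \<cdot> v) w = Theta f' v w"
proof -
  obtain xs u where "xs \<in> lists S" "u \<in> Om1 D" "w = N xs \<star> u"
    by (rule Om1_decomp[OF assms(6)]) (auto simp: reduced_expr_def)
  then show ?thesis
    using assms gal_translate[of f x f' v xs] by (simp add: Theta_eq)
qed

text \<open>The cocycle applied to w t = (w t w^-1) w gives the rule for elements t of T, where it
  takes the value T_t.\<close>

lemma Theta_emb:
  assumes "oriented f" "v \<in> carrier G" "w \<in> carrier V" "rt_elem D c"
  shows "Theta f v w * emb D c = emb D (conj_act D w c) * Theta f v w"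
proof (rule emb_intertwine)
  fix t
  assume t: "t \<in> Tgrp D"
  have "Theta f v w * Tb D t = Theta f v (w \<star> t)"
    using Theta_mult[of f v w t] Theta_T[of f "v \<cdot> \<pi> w" t] assms t by simp
  also have "w \<star> t = w \<star> t \<star> vinv w \<star> w"
    using assms t by (simp add: V.m_assoc)
  also have "Theta f v \<dots> = Tb D (w \<star> t \<star> vinv w) * Theta f v w"
    using Theta_mult[of f v "w \<star> t \<star> vinv w" w] Theta_T[of f v "w \<star> t \<star> vinv w"] assms t by simp
  finally show "Theta f v w * Tb D t = Tb D (w \<star> t \<star> vinv w) * Theta f v w" .
qed (use assms in simp_all)

lemma gal_bern_factor:
  assumes "orientation D ori" "ss \<in> lists S"
  shows "io D (rinv (prod_list (map (sq D) ss))) * prod_list (map (bern_factor D ori ss) [0..<length ss]) =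
    gal (on_W ori) \<one>\<^bsub>G\<^esub> ss"
proof -
  define Y where "Y = (\<lambda>(e::int) s. if e = 1 then Tb D (n s) else Tb D (n s) - emb D (bp D s))"
  have "map (bern_factor D ori ss) [0..<length ss] = map2 Y (signs G (on_W ori) \<one>\<^bsub>G\<^esub> ss) ss"
  proof (rule nth_equalityI)
    fix i
    assume "i < length (map (bern_factor D ori ss) [0..<length ss])"
    then have i: "i < length ss"
      by simp
    have tk: "take i ss \<in> lists S" "ss ! i \<in> S"
      using assms i W.take_lists[of ss i] by auto
    have "ori (N (take i ss)) (ss ! i) = on_W ori (wprod G (take i ss)) (ss ! i)"
      using orientation_on_W(2)[OF assms(1), of "N (take i ss)" "ss ! i"] tk by simp
    then show "map (bern_factor D ori ss) [0..<length ss] ! i = map2 Y (signs G (on_W ori) \<one>\<^bsub>G\<^esub> ss) ss ! i"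
      using i tk W.signs_nth[of "\<one>\<^bsub>G\<^esub>" ss i "on_W ori"] W.lists_carrier[OF assms(2)]
      by (simp add: bern_factor_def N_def[symmetric] Y_def)
  qed simp
  moreover have "io D (rinv (prod_list (map (sq D) ss))) * prod_list (map2 Y es ss) = prod_list (map2 factor es ss)"
    if "length es = length ss" for es
    using that assms(2)
  proof (induction es ss rule: list_induct2)
    case (Cons e es s ss)
    have "io D (rinv (sq D s)) * (io D x * (Y e s * y)) = io D (rinv (sq D s)) * Y e s * (io D x * y)" for x y
      using io_left_commute[of "Y e s" x y] by (simp add: mult.assoc)
    then show ?case
      using Cons by (simp add: rinv_mult sq_unit prod_sq_unit io_mult mult.assoc factor_def Y_def)
  qed simp
  ultimately show ?thesis
    by (simp add: gal_signs)
qed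

text \<open>Whatever expression the choice in \<open>hat_theta\<close> returns, its prescribed
  length makes it reduced. Hence its letters give the normalizing scalar, which the central roots
  distribute over the factors.\<close>

lemma tilde_theta_eq:
  assumes "orientation D ori" "w \<in> carrier V"
  shows "tilde_theta D ori w = Theta (on_W ori) \<one>\<^bsub>G\<^esub> w"
proof -
  let ?P = "\<lambda>x. \<exists>ss u. ss \<in> lists S \<and> length ss = len1 D w \<and> u \<in> Om1 D \<and> w = N ss \<star> u \<and>
      x = prod_list (map (bern_factor D ori ss) [0..<length ss]) * Tb D u"
  have hat: "hat_theta D ori w = (SOME x. ?P x)"
    by (simp add: hat_theta_def N_def)
  obtain xs v where "reduced_expr G S xs (aff_part D (\<pi> w))" "v \<in> Om1 D" "w = N xs \<star> v"
    by (rule Om1_decomp[OF assms(2)])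
  then have "\<exists>x. ?P x"
    unfolding len1_def lenW_def reduced_expr_def by blast
  then have "?P (hat_theta D ori w)"
    unfolding hat by (rule someI_ex)
  then obtain ss u where ss: "ss \<in> lists S" "length ss = len1 D w" "u \<in> Om1 D" "w = N ss \<star> u"
    "hat_theta D ori w = prod_list (map (bern_factor D ori ss) [0..<length ss]) * Tb D u"
    by blast
  have "aff_part D (\<pi> w) = wprod G ss"
    using ss W.wprod_lists_Wa by simp
  then have "reduced_expr G S ss (aff_part D (\<pi> w))"
    using ss by (simp add: reduced_expr_def len1_def lenW_def)
  then have "tilde_theta D ori w = gal (on_W ori) \<one>\<^bsub>G\<^esub> ss * Tb D u"
    using gal_bern_factor[OF assms(1) ss(1)] ss(5)
    by (simp add: tilde_theta_def Lbar_eq mult.assoc[symmetric])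
  then show ?thesis
    using Theta_eq[OF orientation_on_W(1)[OF assms(1)] W.one_closed ss(1,3)] ss(4) by simp
qed

text \<open>Passing between two choices, the parameter contributes T_t with t = g'^-1 g on its
  right, while the cocycle of g'^-1 = t g^-1 contributes T_t on its left, so both choices give the
  same product.\<close>

lemma Xi_eq:
  assumes "orientation D ori" "w \<in> carrier V" "s \<in> S" "\<pi> (w \<star> n s \<star> vinv w) = H"
  shows "Xi D ori H = io D (rinv (sq D s)) * emb D (conj_act D w (bp D s)) *
    Theta (on_W ori) \<one>\<^bsub>G\<^esub> (w \<star> vinv (n s) \<star> vinv w)"
  unfolding Xi_def
proof (rule some_equality, goal_cases)
  case 1
  then show ?case
    using assms tilde_theta_eq[OF assms(1), of "w \<star> vinv (n s) \<star> vinv w"]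
    by (intro exI[of _ w] exI[of _ s]) simp
next
  case (2 x)
  let ?\<theta> = "Theta (on_W ori) \<one>\<^bsub>G\<^esub>"
  have f: "oriented (on_W ori)"
    using assms orientation_on_W by blast
  obtain w' s' where w': "w' \<in> carrier V" "s' \<in> S" "\<pi> (w' \<star> n s' \<star> vinv w') = H"
    and x: "x = io D (rinv (sq D s')) * emb D (conj_act D w' (bp D s')) *
          tilde_theta D ori (w' \<star> vinv (n s') \<star> vinv w')"
    using 2 by blast
  let ?g = "w \<star> n s \<star> vinv w" and ?g' = "w' \<star> vinv (n s') \<star> vinv w'"
  have pi: "\<pi> ?g = \<pi> (w' \<star> n s' \<star> vinv w')"
    using w' assms(4) by simp
  note * = emb_conj_bp[OF assms(3) w'(2) assms(2) w'(1) pi]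
  have "?g' = ?g' \<star> ?g \<star> (w \<star> vinv (n s) \<star> vinv w)"
    using assms(2,3) w'(1,2) by (simp add: V.m_assoc)
  then have "?\<theta> ?g' = Tb D (?g' \<star> ?g) * ?\<theta> (w \<star> vinv (n s) \<star> vinv w)"
    using Theta_mult[OF f W.one_closed, of "?g' \<star> ?g" "w \<star> vinv (n s) \<star> vinv w"]
      Theta_T[OF f W.one_closed *(2)] Tgrp_pi[OF *(2)] assms(2,3) w'(1,2) by simp
  then show ?case
    using * x tilde_theta_eq[OF assms(1), of ?g'] w' assms by (simp add: mult.assoc)
qed

section \<open>Adjacency and the telescoping sum\<close>

lemma adjacent_on_W:
  assumes "orientation D ori" "orientation D ori'" "adjacent D ori ori'"
    and H: "H \<in> hyperplanes G (Waf D) S" "H \<in> carrier G" "o1H D ori H \<noteq> o1H D ori' H"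
    and "v \<in> carrier G" "s \<in> S"
  shows "on_W ori (H \<cdot> v) s = on_W ori' v s"
proof -
  have "orient_act D ori H (lift D v) s = ori' (lift D v) s"
    using assms lift_carrier unfolding adjacent_def by blast
  then show ?thesis
    using orientation_on_W(2)[OF assms(1), of "lift D H \<star> lift D v" s] assms
    by (simp add: orient_act_def lift_carrier pi_lift on_W_def)
qed

lemma gal_one_Theta:
  "oriented f \<Longrightarrow> xs \<in> lists S \<Longrightarrow> gal f \<one>\<^bsub>G\<^esub> xs = Theta f \<one>\<^bsub>G\<^esub> (N xs)"
  using Theta_eq[of f "\<one>\<^bsub>G\<^esub>" xs "\<one>\<^bsub>V\<^esub>"] by (simp add: Tgrp_Om1)

lemma gal_diff_last:
  assumes ori: "orientation D ori" and ori': "orientation D ori'" and "adjacent D ori ori'"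
    and xs: "xs \<in> lists S" and s: "s \<in> S"
    and H: "H = wprod G xs \<cdot> s \<cdot> winv (wprod G xs)"
    and dis: "o1H D ori H \<noteq> o1H D ori' H"
    and sgn: "on_W ori' (wprod G xs) s = - on_W ori (wprod G xs) s"
  shows "gal (on_W ori') \<one>\<^bsub>G\<^esub> xs *
      (factor (on_W ori (wprod G xs) s) s - factor (on_W ori' (wprod G xs) s) s) =
    of_int (on_W ori (wprod G xs) s) * Xi D ori' H * gal (on_W ori) \<one>\<^bsub>G\<^esub> (xs @ [s])"
proof -
  let ?f = "on_W ori" and ?f' = "on_W ori'" and ?v = "wprod G xs" and ?y = "N xs"
    and ?e = "\<one>\<^bsub>G\<^esub>"
  define c b g where "c = io D (rinv (sq D s))" and "b = emb D (conj_act D ?y (bp D s))"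
    and "g = ?y \<star> vinv (n s) \<star> vinv ?y"
  have f: "oriented ?f" "oriented ?f'"
    using ori ori' orientation_on_W by blast+
  have v: "?v \<in> carrier G" "?y \<in> carrier V" "?v \<in> Waf D" "[s] \<in> lists S"
    using xs s W.wprod_lists_Wa by simp_all
  have Hc: "H \<in> carrier G"
    using v s by (simp add: H)
  have Hh: "H \<in> hyperplanes G (Waf D) S"
    using v s by (auto simp: hyperplanes_def H)
  have g: "g \<in> carrier V" "\<pi> g = H"
    using v xs s by (simp_all add: g_def H W.S_inv)
  have HH: "H \<cdot> H = ?e"
  proof -
    have "H \<cdot> H = ?v \<cdot> (s \<cdot> s) \<cdot> winv ?v"
      using v s by (simp add: H W.m_assoc)
    then show ?thesis
      using v s by (simp add: W.S_sq)
  qed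
  \<comment> \<open>Adjacency says that translation by H turns o into o'; since H is an involution
    it also turns o' into o.\<close>
  have shift: "?f' (H \<cdot> x) t = ?f x t" if "x \<in> carrier G" "t \<in> S" for x t
    using adjacent_on_W[OF assms(1-3) Hh Hc dis, of "H \<cdot> x" t] that Hc HH
    by (simp add: W.m_assoc[symmetric])
  \<comment> \<open>Here y is g times the lifted word y n_s, and g projects to H. So o' reads the
    second part from the chamber H, where it looks like o from the unit chamber.\<close>
  have "Theta ?f' ?e ?y = Theta ?f' ?e (g \<star> N (xs @ [s]))"
    using v s xs by (simp add: g_def N_append V.m_assoc)
  also have "\<dots> = Theta ?f' ?e g * Theta ?f' (H \<cdot> ?e) (N (xs @ [s]))"
    using Theta_mult[OF f(2), of ?e g "N (xs @ [s])"] g Hc xs s by simp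
  also have "Theta ?f' (H \<cdot> ?e) (N (xs @ [s])) = gal ?f ?e (xs @ [s])"
    using Theta_translate[OF f(2,1) shift Hc, of ?e "N (xs @ [s])"] f xs s
    by (simp add: gal_one_Theta)
  finally have y: "Theta ?f' ?e ?y = Theta ?f' ?e g * gal ?f ?e (xs @ [s])" .
  have "Theta ?f' ?e ?y * (c * emb D (bp D s)) = c * b * Theta ?f' ?e ?y"
    using Theta_emb[OF f(2), of ?e ?y "bp D s"] v s
    by (simp add: c_def b_def io_left_commute bp_rt mult.assoc)
  also have "\<dots> = Xi D ori' H * gal ?f ?e (xs @ [s])"
    using Xi_eq[OF ori' v(2) s, of H] xs s by (simp add: y c_def b_def g_def H mult.assoc)
  finally have main: "gal ?f' ?e xs * (c * emb D (bp D s)) = Xi D ori' H * gal ?f ?e (xs @ [s])"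
    using f xs by (simp add: gal_one_Theta)
  \<comment> \<open>The signs are opposite, so this is the plus factor minus the minus factor,
    multiplied by the sign of o.\<close>
  have "factor (?f ?v s) s - factor (?f' ?v s) s = of_int (?f ?v s) * (c * emb D (bp D s))"
    using oriented_sign[OF f(1) v(1) s] factor_diff[OF s]
    by (auto simp: sgn c_def algebra_simps)
  moreover have "gal ?f' ?e xs * (of_int (?f ?v s) * (c * emb D (bp D s))) =
      of_int (?f ?v s) * (gal ?f' ?e xs * (c * emb D (bp D s)))"
    using oriented_sign[OF f(1) v(1) s] by auto
  ultimately show ?thesis
    by (simp add: main mult.assoc)
qed

lemma gal_diff:
  assumes ori: "orientation D ori" and ori': "orientation D ori'" and "adjacent D ori ori'"
    and "xs \<in> lists S" "distinct (refls G \<one>\<^bsub>G\<^esub> xs)"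
  shows "gal (on_W ori) \<one>\<^bsub>G\<^esub> xs - gal (on_W ori') \<one>\<^bsub>G\<^esub> xs =
    (\<Sum>H\<in>{H \<in> set (refls G \<one>\<^bsub>G\<^esub> xs). o1H D ori H \<noteq> o1H D ori' H}.
        of_int (o1H D ori H) * Xi D ori' H) * gal (on_W ori) \<one>\<^bsub>G\<^esub> xs"
  using assms(4,5)
proof (induction xs rule: rev_induct)
  case (snoc s xs)
  let ?f = "on_W ori" and ?f' = "on_W ori'" and ?v = "wprod G xs" and ?e = "\<one>\<^bsub>G\<^esub>"
  let ?D = "{H \<in> set (refls G ?e xs). o1H D ori H \<noteq> o1H D ori' H}"
    and ?F = "\<lambda>H. of_int (o1H D ori H) * Xi D ori' H"
  define H where "H = ?v \<cdot> s \<cdot> winv ?v"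
  have mem: "xs \<in> lists S" "s \<in> S" "[s] \<in> lists S" "?v \<in> Waf D" "?v \<in> carrier G"
    using snoc.prems W.wprod_lists_Wa by simp_all
  have refls: "refls G ?e (xs @ [s]) = refls G ?e xs @ [H]"
    using mem by (simp add: W.refls_append H_def)
  then have dist: "distinct (refls G ?e xs)" "H \<notin> set (refls G ?e xs)"
    using snoc.prems by auto
  \<comment> \<open>The gallery has not met H before its last step, so H leaves the unit chamber and
    \<open>?v\<close> on the same side and the sign of the last step is the one seen from 1.\<close>
  have "H \<notin> sep1 G S ?v"
    using W.sep1_subset_refls mem dist by blast
  then have o1: "o1H D ori H = ?f ?v s" "o1H D ori' H = ?f' ?v s"
    using mem by (auto simp: H_def intro!: o1H_eq ori ori')
  have gal: "gal g ?e (xs @ [s]) = gal g ?e xs * factor (g ?v s) s" for g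
    using mem by (simp add: gal_append)
  \<comment> \<open>The prefix difference is paired with the last factor of o, not of o', so that
    the full product for o reappears on the right and the sum stays on the left.\<close>
  have "gal ?f ?e (xs @ [s]) - gal ?f' ?e (xs @ [s]) =
      (gal ?f ?e xs - gal ?f' ?e xs) * factor (?f ?v s) s +
      gal ?f' ?e xs * (factor (?f ?v s) s - factor (?f' ?v s) s)"
    by (simp add: gal algebra_simps)
  also have "(gal ?f ?e xs - gal ?f' ?e xs) * factor (?f ?v s) s = sum ?F ?D * gal ?f ?e (xs @ [s])"
    using snoc.IH mem dist by (simp add: gal mult.assoc)
  finally have step: "gal ?f ?e (xs @ [s]) - gal ?f' ?e (xs @ [s]) =
      sum ?F ?D * gal ?f ?e (xs @ [s]) + gal ?f' ?e xs * (factor (?f ?v s) s - factor (?f' ?v s) s)" .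
  show ?case
  proof (cases "o1H D ori H = o1H D ori' H")
    case True
    then have "{H \<in> set (refls G ?e (xs @ [s])). o1H D ori H \<noteq> o1H D ori' H} = ?D"
      by (auto simp: refls)
    then show ?thesis
      using step True o1 by simp
  next
    case False
    have "{H \<in> set (refls G ?e (xs @ [s])). o1H D ori H \<noteq> o1H D ori' H} = insert H ?D"
      using False by (auto simp: refls)
    moreover have "sum ?F (insert H ?D) = ?F H + sum ?F ?D"
      using dist by (intro sum.insert) auto
    moreover have "?f' ?v s = - ?f ?v s"
      using False o1 mem oriented_sign[OF orientation_on_W(1)[OF ori], of ?v s]
        oriented_sign[OF orientation_on_W(1)[OF ori'], of ?v s] by auto
    ultimately show ?thesis
      using step gal_diff_last[OF assms(1-3) mem(1,2) H_def False] by (simp add: o1 algebra_simps)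
  qed
qed simp

end

theorem theorem2p10p3:
  fixes D :: "('w, 'v, 'r::comm_ring_1, 'h::ring_1) phdata"
    and ori ori' :: "'v \<Rightarrow> 'w \<Rightarrow> int"
    and w :: 'v
  assumes "generic_hecke D"
    and "sqrt_choice D"
    and "w \<in> carrier (W1g D)"
    and "orientation D ori" and "orientation D ori'"
    and "adjacent D ori ori'"
  shows "tilde_theta D ori w - tilde_theta D ori' w =
    (\<Sum>H\<in>{H \<in> hyperplanes (Wg D) (Waf D) (Sg D).
            H \<in> sep1 (Wg D) (Sg D) (aff_part D (prj D w)) \<and> o1H D ori H \<noteq> o1H D ori' H}.
        of_int (o1H D ori H) * Xi D ori' H) * tilde_theta D ori w"
proof -
  interpret hecke D
    using assms by unfold_locales
  obtain xs u where xs: "reduced_expr G S xs (aff_part D (\<pi> w))" "u \<in> Om1 D" "w = N xs \<star> u"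
    by (rule Om1_decomp[OF assms(3)])
  then have L: "xs \<in> lists S"
    by (simp add: reduced_expr_def)
  \<comment> \<open>Separating hyperplanes are walls of a gallery inside W_aff, so the index set of
    the sum is the set of walls of \<open>xs\<close> at which the orientations disagree.\<close>
  have "H \<in> hyperplanes G (Waf D) S" if "H \<in> set (refls G v xs)" "v \<in> Waf D" for H v
    using that L by (induction xs arbitrary: v) (auto simp: hyperplanes_def)
  then have "{H \<in> hyperplanes G (Waf D) S. H \<in> sep1 G S (aff_part D (\<pi> w)) \<and> o1H D ori H \<noteq> o1H D ori' H} =
      {H \<in> set (refls G \<one>\<^bsub>G\<^esub> xs). o1H D ori H \<noteq> o1H D ori' H}"
    by (auto simp: W.sep1_eq[OF xs(1)])
  moreover have "tilde_theta D f w = gal (on_W f) \<one>\<^bsub>G\<^esub> xs * Tb D u" if "orientation D f" for f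
    using Theta_eq[OF orientation_on_W(1)[OF that] W.one_closed L xs(2)] tilde_theta_eq[OF that assms(3)] xs(3)
    by simp
  ultimately show ?thesis
    using gal_diff[OF assms(4-6) L W.reduced_distinct[OF xs(1)]] assms(4,5)
    by (simp add: left_diff_distrib[symmetric] mult.assoc[symmetric])
qed

end
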